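(* Let $n$ be an odd positive integer, let $T>0$, $s>3/2$, and let $u\in C^0([0,T);H^s(\mathbb{R}))$ be a solution of $$u_t-u_{txx}+\frac{(n+1)(n+2)}{2}u^nu_x=\frac{n(n-1)}{2}u^{n-2}u_x^3+2n u^{n-1}u_xu_{xx}+u^n u_{xxx}.$$ Suppose that for some $t^\ast\in(0,T)$ there are points $a<b$ such that $u_t(t^\ast,a)=u_t(t^\ast,b)=0$ and $u(t^\ast,x)=0$ for all $x\in[a,b]$. Then $u\equiv0$.
   Context: Solutions: the equation is understood in the equivalent nonlocal form $$u_t+u^nu_x+\partial_x(1-\partial_x^2)^{-1}\left(\frac n2u^{n-1}u_x^2+\frac{n(n+3)}{2(n+1)}u^{n+1}\right)=0,$$ where $(1-\partial_x^2)^{-1}f=g*f$ with $g(x)=e^{-|x|}/2$. By a solution one means a real-valued $u\in C^0([0,T);H^s(\mathbb{R}))\cap C^1([0,T);H^{s-1}(\mathbb{R}))$, $s>3/2$, the unique solution of the Cauchy problem with $u(0,\cdot)=u_0\in H^s(\mathbb{R})$. For such solutions $\|u(t,\cdot)\|_{H^1(\mathbb{R})}$ is independent of $t$. *)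

theory Defs
  imports "HOL-Analysis.Analysis"
begin

definition square_integrable :: "(real \<Rightarrow> 'a::{banach, second_countable_topology}) \<Rightarrow> bool" where
  "square_integrable f \<longleftrightarrow>
     f \<in> borel_measurable lborel \<and> integrable lborel (\<lambda>x. (norm (f x))\<^sup>2)"

definition truncated_fourier :: "(real \<Rightarrow> real) \<Rightarrow> real \<Rightarrow> real \<Rightarrow> complex" where
  "truncated_fourier f R \<xi> = (LINT x:{-R..R}|lborel. cis (- (\<xi> * x)) * complex_of_real (f x))"

text \<open>The Fourier--Plancherel transform of a square-integrable function is the $L^2$-limit of
  the transforms of its truncations; it is determined only up to null sets, hence a relation.
  The convergence is measured by the nonnegative integral, which is infinite (rather than 0)
  when the integrand is not integrable.\<close>

definition has_fourier_transform :: "(real \<Rightarrow> real) \<Rightarrow> (real \<Rightarrow> complex) \<Rightarrow> bool" where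
  "has_fourier_transform f F \<longleftrightarrow>
     square_integrable f \<and> square_integrable F \<and>
     ((\<lambda>R. \<integral>\<^sup>+ \<xi>. ennreal ((cmod (F \<xi> - truncated_fourier f R \<xi>))\<^sup>2) \<partial>lborel) \<longlongrightarrow> 0) at_top"

text \<open>Real-valued $H^r(\mathbb{R})$ for $r \ge 0$ (for negative $r$ the elements would be
  distributions).\<close>

definition sobolev :: "real \<Rightarrow> (real \<Rightarrow> real) set" where
  "sobolev r = {f. \<exists>F. has_fourier_transform f F \<and>
     integrable lborel (\<lambda>\<xi>. (1 + \<xi>\<^sup>2) powr r * (cmod (F \<xi>))\<^sup>2)}"

text \<open>The norm does not depend on the chosen representative of the transform. The
  transform carries no factor involving $2\pi$, which changes the norm by a constant only.
  The norm is meaningful on \<^term>\<open>sobolev r\<close> only.\<close>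

definition sobolev_norm :: "real \<Rightarrow> (real \<Rightarrow> real) \<Rightarrow> real" where
  "sobolev_norm r f =
     sqrt (LINT \<xi>|lborel. (1 + \<xi>\<^sup>2) powr r * (cmod ((SOME F. has_fourier_transform f F) \<xi>))\<^sup>2)"

text \<open>Curves in $C^0([0,T);H^r(\mathbb{R}))$. For $r > 1/2$ every class in $H^r(\mathbb{R})$ has
  exactly one continuous representative, and point values always refer to it.\<close>

definition sobolev_C0 :: "real \<Rightarrow> real \<Rightarrow> (real \<Rightarrow> real \<Rightarrow> real) \<Rightarrow> bool" where
  "sobolev_C0 T r u \<longleftrightarrow>
     (\<forall>t\<in>{0..<T}. u t \<in> sobolev r \<and> continuous_on UNIV (u t)) \<and>
     (\<forall>t\<^sub>0\<in>{0..<T}. ((\<lambda>t. sobolev_norm r (\<lambda>x. u t x - u t\<^sub>0 x)) \<longlongrightarrow> 0) (at t\<^sub>0 within {0..<T}))"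

text \<open>\<open>v\<close> is the derivative of the curve \<open>u\<close> in the norm of $H^r(\mathbb{R})$, one-sided at
  time 0.\<close>

definition sobolev_time_deriv ::
  "real \<Rightarrow> real \<Rightarrow> (real \<Rightarrow> real \<Rightarrow> real) \<Rightarrow> (real \<Rightarrow> real \<Rightarrow> real) \<Rightarrow> bool" where
  "sobolev_time_deriv T r u v \<longleftrightarrow>
     (\<forall>t\<^sub>0\<in>{0..<T}.
        ((\<lambda>t. sobolev_norm r (\<lambda>x. (u t x - u t\<^sub>0 x) / (t - t\<^sub>0) - v t\<^sub>0 x)) \<longlongrightarrow> 0)
          (at t\<^sub>0 within {0..<T}))"

text \<open>$(1-\partial_x^2)^{-1} f = g * f$ with $g(x) = e^{-|x|}/2$.\<close>

definition inverse_helmholtz :: "(real \<Rightarrow> real) \<Rightarrow> real \<Rightarrow> real" where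
  "inverse_helmholtz f x = (LINT y|lborel. exp (- \<bar>x - y\<bar>) / 2 * f y)"

definition nonlocal_density :: "nat \<Rightarrow> (real \<Rightarrow> real) \<Rightarrow> real \<Rightarrow> real" where
  "nonlocal_density n w x =
     real n / 2 * w x ^ (n - 1) * (deriv w x)\<^sup>2
     + real n * (real n + 3) / (2 * (real n + 1)) * w x ^ (n + 1)"

text \<open>Solutions on $[0,T)$ of
  $$u_t-u_{txx}+\tfrac{(n+1)(n+2)}{2}u^nu_x
    =\tfrac{n(n-1)}{2}u^{n-2}u_x^3+2n u^{n-1}u_xu_{xx}+u^n u_{xxx},$$
  understood in the equivalent nonlocal form, in the class
  $C^0([0,T);H^s)\cap C^1([0,T);H^{s-1})$. For $s > 3/2$ all terms of the nonlocal
  equation are continuous in $x$, so it is imposed at every point, and the spatial derivatives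
  are classical.\<close>

definition solution :: "nat \<Rightarrow> real \<Rightarrow> real \<Rightarrow> (real \<Rightarrow> real \<Rightarrow> real) \<Rightarrow> bool" where
  "solution n T s u \<longleftrightarrow>
     sobolev_C0 T s u \<and>
     (\<exists>u\<^sub>t. sobolev_C0 T (s - 1) u\<^sub>t \<and> sobolev_time_deriv T (s - 1) u u\<^sub>t \<and>
       (\<forall>t\<in>{0..<T}. \<forall>x.
          u\<^sub>t t x + u t x ^ n * deriv (u t) x
          + deriv (inverse_helmholtz (nonlocal_density n (u t))) x = 0))"

end

theory Submission
  imports Defs "HOL-Probability.Probability"
begin

text \<open>Let \<open>F\<close> be the nonlocal density and \<open>P = g * F\<close>. Since \<open>n\<close> is odd, \<open>F \<ge> 0\<close>, and \<open>F\<close> vanishes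
  exactly where \<open>u\<close> does. At time \<open>t\<^sup>*\<close> the equation at \<open>a\<close> and \<open>b\<close> gives \<open>P'(a) = P'(b) = 0\<close>; as
  \<open>P'' = P - F = P\<close> inside \<open>(a, b)\<close>, \<open>P\<close> vanishes at some point between them, so the nonnegative
  integrand of \<open>g * F\<close> vanishes there, that is, \<open>F = 0\<close> and \<open>u(t\<^sup>*, \<cdot>) = 0\<close> on the whole line.

  Instead of conservation of the \<open>H\<^sup>1\<close> norm, uniqueness for zero data is then shown in \<open>W\<^sup>1\<^sup>,\<^sup>\<infinity>\<close>.
  Sobolev embedding turns the solution into a classical one of the transport equation
  \<open>u\<^sub>t + u\<^sup>n u\<^sub>x = - p\<close>, \<open>p = P'\<close>, where the sup norm and the Lipschitz constant of \<open>p\<close> are bounded by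
  a multiple of the size of \<open>(u, u\<^sub>x)\<close>. Following \<open>u\<close> and its spatial differences along polygonal
  approximations of the characteristics shows that a bound for \<open>(u, u\<^sub>x)\<close> on a short time interval
  starting at zero data can be halved. Times before \<open>t\<^sup>*\<close> follow from the symmetry
  \<open>u(t, x) \<mapsto> - u(-t, x)\<close>, valid for odd \<open>n\<close>.\<close>

section \<open>The Fourier transform and its inversion\<close>

text \<open>Since only \<open>s > 3/2\<close> is assumed, \<open>u(t, .)\<close> is
  \<open>C^1\<close> and nothing is known about u_xx, so there is no equation for u_x along
  characteristics. The slope is therefore controlled as the Lipschitz constant of \<open>u\<close>,
  by comparing two characteristics. The nonlocal source can take part in this because
  \<open>P'' = P - F\<close> makes \<open>p\<close> Lipschitz although \<open>F\<close> is merely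
  continuous. The estimate closes because \<open>F\<close> is homogeneous of degree
  \<open>n + 1\<close> in \<open>(u, u_x)\<close>: under an a priori bound \<open>K\<close> on a
  compact time interval its size is at most a constant times \<open>K^n N\<close>, linear in the
  current bound \<open>N\<close>. Halving then works on intervals whose length does not depend on
  where they start. The Fourier part is needed because \<open>H^s\<close> is given by L^2 limits of
  truncated transforms, while the argument is pointwise in \<open>x\<close>. The bridge is the
  inversion formula for a continuous function with integrable transform, obtained by Gaussian
  summation.\<close>

lemma borel_measurable_cis [measurable (raw)]:
  assumes "f \<in> borel_measurable M"
  shows "(\<lambda>x. cis (f x)) \<in> borel_measurable M"
proof -
  have "continuous_on UNIV cis"
    by (intro continuous_intros)
  then show ?thesis
    using assms by (rule borel_measurable_continuous_on)
qed

lemma integrable_bound_everywhere: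
  fixes f :: "'a \<Rightarrow> 'b::{banach, second_countable_topology}" and g :: "'a \<Rightarrow> real"
  assumes "f \<in> borel_measurable M" "integrable M g" "\<And>x. norm (f x) \<le> g x"
  shows "integrable M f"
  using assms(2,1)
proof (rule Bochner_Integration.integrable_bound)
  show "AE x in M. norm (f x) \<le> norm (g x)"
    using assms(3) by (auto intro: order_trans[OF _ abs_ge_self])
qed

lemma square_integrable_imp_set_integrable:
  fixes f :: "real \<Rightarrow> real"
  assumes "square_integrable f"
  shows "set_integrable lborel {-R..R} f"
proof -
  have [measurable]: "f \<in> borel_measurable borel" and f2: "integrable lborel (\<lambda>x. (f x)\<^sup>2)"
    using assms by (auto simp: square_integrable_def)
  have "integrable lborel (\<lambda>x. indicator {-R..R} x + (f x)\<^sup>2)"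
    by (intro Bochner_Integration.integrable_add f2) (simp add: emeasure_lborel_Icc_eq)
  moreover have "norm (indicator {-R..R} x *\<^sub>R f x) \<le> indicator {-R..R} x + (f x)\<^sup>2" for x
  proof -
    have "\<bar>f x\<bar> \<le> 1 + (f x)\<^sup>2"
      using sum_squares_bound[of "\<bar>f x\<bar>" 1] by (simp add: power2_eq_square)
    then show ?thesis by (auto simp: indicator_def)
  qed
  ultimately show ?thesis
    unfolding set_integrable_def by (rule integrable_bound_everywhere[rotated]) measurable
qed

lemma square_integrable_mult:
  fixes f :: "real \<Rightarrow> 'a::{banach, second_countable_topology, real_normed_algebra}"
  assumes "square_integrable f" "square_integrable g"
  shows "integrable lborel (\<lambda>x. f x * g x)"
proof -
  have [measurable]: "f \<in> borel_measurable borel" "g \<in> borel_measurable borel"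
    using assms by (auto simp: square_integrable_def)
  have "integrable lborel (\<lambda>x. (norm (f x))\<^sup>2 + (norm (g x))\<^sup>2)"
    using assms by (intro Bochner_Integration.integrable_add) (auto simp: square_integrable_def)
  moreover have "norm (f x * g x) \<le> (norm (f x))\<^sup>2 + (norm (g x))\<^sup>2" for x
  proof -
    have "norm (f x * g x) \<le> norm (f x) * norm (g x)" by (rule norm_mult_ineq)
    also have "\<dots> \<le> (norm (f x))\<^sup>2 + (norm (g x))\<^sup>2"
      using sum_squares_bound[of "norm (f x)" "norm (g x)"]
        mult_nonneg_nonneg[OF norm_ge_zero[of "f x"] norm_ge_zero[of "g x"]]
      by linarith
    finally show ?thesis by simp
  qed
  ultimately show ?thesis
    by (rule integrable_bound_everywhere[rotated]) measurable
qed

lemma square_integrable_lincomb: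
  fixes f g :: "real \<Rightarrow> 'a::{banach, second_countable_topology, real_normed_field}"
  assumes "square_integrable f" "square_integrable g"
  shows "square_integrable (\<lambda>x. a * f x + b * g x)"
proof -
  have [measurable]: "f \<in> borel_measurable borel" "g \<in> borel_measurable borel"
    using assms by (auto simp: square_integrable_def)
  have "integrable lborel (\<lambda>x. 2 * (norm a)\<^sup>2 * (norm (f x))\<^sup>2 + 2 * (norm b)\<^sup>2 * (norm (g x))\<^sup>2)"
    using assms by (intro Bochner_Integration.integrable_add) (auto simp: square_integrable_def)
  moreover have "norm ((norm (a * f x + b * g x))\<^sup>2) \<le>
     2 * (norm a)\<^sup>2 * (norm (f x))\<^sup>2 + 2 * (norm b)\<^sup>2 * (norm (g x))\<^sup>2" for x
  proof -
    have "(norm (a * f x + b * g x))\<^sup>2 \<le> (norm (a * f x) + norm (b * g x))\<^sup>2"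
      by (intro power_mono norm_triangle_ineq) auto
    also have "\<dots> \<le> 2 * (norm (a * f x))\<^sup>2 + 2 * (norm (b * g x))\<^sup>2"
      using sum_squares_bound[of "norm (a * f x)" "norm (b * g x)"]
      by (simp add: power2_sum)
    finally show ?thesis by (simp add: norm_mult power_mult_distrib)
  qed
  ultimately have "integrable lborel (\<lambda>x. (norm (a * f x + b * g x))\<^sup>2)"
    by (rule integrable_bound_everywhere[rotated]) measurable
  then show ?thesis by (simp add: square_integrable_def)
qed

lemma set_integrable_cis_mult:
  fixes f :: "real \<Rightarrow> real"
  assumes "set_integrable lborel A f"
  shows "set_integrable lborel A (\<lambda>x. cis (c * x) * complex_of_real (f x))"
proof -
  have *: "integrable lborel (\<lambda>x. indicator A x *\<^sub>R f x)"
    using assms by (simp add: set_integrable_def)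
  then have [measurable]: "(\<lambda>x. indicator A x *\<^sub>R f x) \<in> borel_measurable borel"
    by auto
  have "(\<lambda>x. indicator A x *\<^sub>R (cis (c * x) * complex_of_real (f x)))
      = (\<lambda>x. cis (c * x) * complex_of_real (indicator A x *\<^sub>R f x))"
    by (auto simp: indicator_def)
  moreover have "integrable lborel (\<lambda>x. cis (c * x) * complex_of_real (indicator A x *\<^sub>R f x))"
  proof (rule Bochner_Integration.integrable_bound[OF *])
    show "(\<lambda>x. cis (c * x) * complex_of_real (indicator A x *\<^sub>R f x)) \<in> borel_measurable lborel"
      by measurable
  qed (auto simp: norm_mult)
  ultimately show ?thesis by (simp add: set_integrable_def)
qed

section \<open>Linearity and uniqueness of the Plancherel transform\<close>

lemma truncated_fourier_lincomb:
  assumes "square_integrable f" "square_integrable g"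
  shows "truncated_fourier (\<lambda>x. a * f x + b * g x) R \<xi>
       = complex_of_real a * truncated_fourier f R \<xi> + complex_of_real b * truncated_fourier g R \<xi>"
proof -
  have i: "set_integrable lborel {-R..R} (\<lambda>x. complex_of_real c * (cis (- (\<xi> * x)) * complex_of_real (h x)))"
    if "square_integrable h" for c h
    using set_integrable_cis_mult[OF square_integrable_imp_set_integrable[OF that], of R "-\<xi>"]
    by (intro set_integrable_mult_right) simp
  have "truncated_fourier (\<lambda>x. a * f x + b * g x) R \<xi> =
    (LINT x:{-R..R}|lborel. complex_of_real a * (cis (- (\<xi> * x)) * complex_of_real (f x))
       + complex_of_real b * (cis (- (\<xi> * x)) * complex_of_real (g x)))"
    unfolding truncated_fourier_def by (simp add: algebra_simps)
  also have "\<dots> = complex_of_real a * truncated_fourier f R \<xi> + complex_of_real b * truncated_fourier g R \<xi>"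
    unfolding truncated_fourier_def
    by (subst set_integral_add(2)[OF i[OF assms(1)] i[OF assms(2)]]) simp
  finally show ?thesis .
qed

lemma borel_measurable_truncated_fourier [measurable]:
  assumes [measurable]: "f \<in> borel_measurable borel"
  shows "truncated_fourier f R \<in> borel_measurable borel"
proof -
  have "(\<lambda>(\<xi>, x). indicator {-R..R} x *\<^sub>R (cis (- (\<xi> * x)) * complex_of_real (f x)))
      \<in> borel_measurable (borel \<Otimes>\<^sub>M lborel)"
    by measurable
  then have "(\<lambda>\<xi>. LINT x|lborel. indicator {-R..R} x *\<^sub>R (cis (- (\<xi> * x)) * complex_of_real (f x)))
      \<in> borel_measurable borel"
    by (rule lborel.borel_measurable_lebesgue_integral)
  moreover have "truncated_fourier f R = (\<lambda>\<xi>. LINT x|lborel. indicator {-R..R} x *\<^sub>R (cis (- (\<xi> * x)) * complex_of_real (f x)))"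
    by (simp add: fun_eq_iff truncated_fourier_def set_lebesgue_integral_def)
  ultimately show ?thesis by simp
qed

text \<open>From \<open>|y + z|^2 <= 2 |y|^2 + 2 |z|^2\<close>. It stays in nonnegative integrals
  because \<open>has_fourier_transform\<close> measures convergence there; both the linearity and
  the uniqueness of the transform rest on it.\<close>

lemma nn_integral_lincomb_square_le:
  fixes f g :: "real \<Rightarrow> complex"
  assumes [measurable]: "f \<in> borel_measurable borel" "g \<in> borel_measurable borel"
  shows "(\<integral>\<^sup>+ x. ennreal ((cmod (a * f x + b * g x))\<^sup>2) \<partial>lborel)
    \<le> ennreal (2 * (cmod a)\<^sup>2) * (\<integral>\<^sup>+ x. ennreal ((cmod (f x))\<^sup>2) \<partial>lborel)
     + ennreal (2 * (cmod b)\<^sup>2) * (\<integral>\<^sup>+ x. ennreal ((cmod (g x))\<^sup>2) \<partial>lborel)"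
proof -
  have "(cmod (a * f x + b * g x))\<^sup>2 \<le> 2 * (cmod a)\<^sup>2 * (cmod (f x))\<^sup>2 + 2 * (cmod b)\<^sup>2 * (cmod (g x))\<^sup>2" for x
  proof -
    have "(cmod (a * f x + b * g x))\<^sup>2 \<le> (cmod (a * f x) + cmod (b * g x))\<^sup>2"
      by (intro power_mono norm_triangle_ineq) auto
    also have "\<dots> \<le> 2 * (cmod (a * f x))\<^sup>2 + 2 * (cmod (b * g x))\<^sup>2"
      using sum_squares_bound[of "cmod (a * f x)" "cmod (b * g x)"]
      by (simp add: power2_sum)
    finally show ?thesis by (simp add: norm_mult power_mult_distrib)
  qed
  then have "(\<integral>\<^sup>+ x. ennreal ((cmod (a * f x + b * g x))\<^sup>2) \<partial>lborel)
    \<le> (\<integral>\<^sup>+ x. ennreal (2 * (cmod a)\<^sup>2) * ennreal ((cmod (f x))\<^sup>2)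
             + ennreal (2 * (cmod b)\<^sup>2) * ennreal ((cmod (g x))\<^sup>2) \<partial>lborel)"
    by (intro nn_integral_mono) (simp add: ennreal_mult'[symmetric] ennreal_plus[symmetric] del: ennreal_plus)
  also have "\<dots> = ennreal (2 * (cmod a)\<^sup>2) * (\<integral>\<^sup>+ x. ennreal ((cmod (f x))\<^sup>2) \<partial>lborel)
     + ennreal (2 * (cmod b)\<^sup>2) * (\<integral>\<^sup>+ x. ennreal ((cmod (g x))\<^sup>2) \<partial>lborel)"
    by (subst nn_integral_add) (auto simp: nn_integral_cmult)
  finally show ?thesis .
qed

lemma tendsto_zero_ennreal_lincomb:
  fixes f g :: "'a \<Rightarrow> ennreal"
  assumes "(f \<longlongrightarrow> 0) A" "(g \<longlongrightarrow> 0) A" "a < top" "b < top"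
  shows "((\<lambda>x. a * f x + b * g x) \<longlongrightarrow> 0) A"
proof -
  have "((\<lambda>x. a * f x + b * g x) \<longlongrightarrow> a * 0 + b * 0) A"
    using assms by (intro tendsto_add ennreal_tendsto_cmult) auto
  then show ?thesis by simp
qed

lemma tendsto_zero_ennreal_mono:
  fixes f g :: "'a \<Rightarrow> ennreal"
  assumes "(g \<longlongrightarrow> 0) A" "\<And>x. f x \<le> g x"
  shows "(f \<longlongrightarrow> 0) A"
proof (rule tendsto_sandwich[OF _ _ tendsto_const assms(1)])
  show "\<forall>\<^sub>F x in A. 0 \<le> f x" by simp
  show "\<forall>\<^sub>F x in A. f x \<le> g x" using assms(2) by simp
qed

lemma has_fourier_transform_lincomb:
  assumes f: "has_fourier_transform f F" and g: "has_fourier_transform g G"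
  shows "has_fourier_transform (\<lambda>x. a * f x + b * g x)
           (\<lambda>\<xi>. complex_of_real a * F \<xi> + complex_of_real b * G \<xi>)"
proof -
  have [measurable]: "f \<in> borel_measurable borel" "g \<in> borel_measurable borel"
      "F \<in> borel_measurable borel" "G \<in> borel_measurable borel"
    and sq: "square_integrable f" "square_integrable g" "square_integrable F" "square_integrable G"
    using f g by (auto simp: has_fourier_transform_def square_integrable_def)
  let ?E = "\<lambda>f F R. \<integral>\<^sup>+ \<xi>. ennreal ((cmod (F \<xi> - truncated_fourier f R \<xi>))\<^sup>2) \<partial>lborel"
  let ?h = "\<lambda>x. a * f x + b * g x" and ?H = "\<lambda>\<xi>. complex_of_real a * F \<xi> + complex_of_real b * G \<xi>"
  have "?E ?h ?H R \<le> ennreal (2 * (cmod a)\<^sup>2) * ?E f F R + ennreal (2 * (cmod b)\<^sup>2) * ?E g G R" for R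
  proof -
    have "?H \<xi> - truncated_fourier ?h R \<xi> = complex_of_real a * (F \<xi> - truncated_fourier f R \<xi>)
        + complex_of_real b * (G \<xi> - truncated_fourier g R \<xi>)" for \<xi>
      by (simp add: truncated_fourier_lincomb[OF sq(1,2)] algebra_simps)
    then show ?thesis
      by (simp only:) (rule nn_integral_lincomb_square_le; measurable)
  qed
  moreover have "((\<lambda>R. ennreal (2 * (cmod a)\<^sup>2) * ?E f F R + ennreal (2 * (cmod b)\<^sup>2) * ?E g G R) \<longlongrightarrow> 0) at_top"
    using f g by (intro tendsto_zero_ennreal_lincomb) (auto simp: has_fourier_transform_def)
  ultimately have "((\<lambda>R. ?E ?h ?H R) \<longlongrightarrow> 0) at_top"
    by (rule tendsto_zero_ennreal_mono[rotated])
  then show ?thesis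
    using square_integrable_lincomb[OF sq(1,2)] square_integrable_lincomb[OF sq(3,4)]
    by (simp add: has_fourier_transform_def)
qed

lemma has_fourier_transform_unique:
  assumes F: "has_fourier_transform f F" and G: "has_fourier_transform f G"
  shows "AE \<xi> in lborel. F \<xi> = G \<xi>"
proof -
  have [measurable]: "f \<in> borel_measurable borel"
      "F \<in> borel_measurable borel" "G \<in> borel_measurable borel"
    using F G by (auto simp: has_fourier_transform_def square_integrable_def)
  let ?E = "\<lambda>F R. \<integral>\<^sup>+ \<xi>. ennreal ((cmod (F \<xi> - truncated_fourier f R \<xi>))\<^sup>2) \<partial>lborel"
  let ?I = "\<integral>\<^sup>+ \<xi>. ennreal ((cmod (F \<xi> - G \<xi>))\<^sup>2) \<partial>lborel"
  have "?I \<le> ennreal 2 * ?E F R + ennreal 2 * ?E G R" for R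
    using nn_integral_lincomb_square_le[of "\<lambda>\<xi>. F \<xi> - truncated_fourier f R \<xi>" "\<lambda>\<xi>. G \<xi> - truncated_fourier f R \<xi>" 1 "-1"]
    by simp
  moreover have "((\<lambda>R. ennreal 2 * ?E F R + ennreal 2 * ?E G R) \<longlongrightarrow> 0) at_top"
    using F G by (intro tendsto_zero_ennreal_lincomb) (auto simp: has_fourier_transform_def)
  \<comment> \<open>\<open>?I\<close> does not depend on \<open>R\<close>, so the limit along
    \<open>at_top\<close> determines its value.\<close>
  ultimately have "((\<lambda>R::real. ?I) \<longlongrightarrow> 0) at_top"
    by (rule tendsto_zero_ennreal_mono[rotated])
  then have "?I = 0"
    by (simp add: tendsto_const_iff)
  then have "AE \<xi> in lborel. ennreal ((cmod (F \<xi> - G \<xi>))\<^sup>2) = 0"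
    by (subst (asm) nn_integral_0_iff_AE) auto
  then show ?thesis by eventually_elim simp
qed

section \<open>Gaussian summation and the inversion formula\<close>

lemma integral_std_normal_cis:
  "(LINT x|lborel. cis (t * x) * complex_of_real (std_normal_density x)) = complex_of_real (exp (- (t^2) / 2))"
proof -
  have "complex_of_real (exp (- (t^2) / 2)) = char std_normal_distribution t"
    by (simp add: char_std_normal_distribution)
  also have "\<dots> = (LINT x|lborel. std_normal_density x *\<^sub>R cis (t * x))"
    unfolding char_def cis_conv_exp
    by (subst integral_density) (auto simp: normal_density_nonneg)
  finally show ?thesis by (simp add: scaleR_conv_of_real mult.commute)
qed

text \<open>The summability factor of the inversion. It tends to 1 as \<open>m\<close> grows, and
  multiplied by it the merely square-integrable \<open>F\<close> becomes integrable. For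
  \<open>m > 0\<close> its transform is \<open>2 * pi\<close> times the centred normal density with
  standard deviation \<open>1 / m\<close>.\<close>

definition gauss_cutoff :: "real \<Rightarrow> real \<Rightarrow> real" where
  "gauss_cutoff m \<xi> = exp (- (\<xi> / m)\<^sup>2 / 2)"

lemma gauss_cutoff_measurable [measurable]: "gauss_cutoff m \<in> borel_measurable borel"
  unfolding gauss_cutoff_def by measurable

lemma gauss_cutoff_eq: "m > 0 \<Longrightarrow> gauss_cutoff m \<xi> = sqrt (2 * pi) * std_normal_density (\<xi> / m)"
  by (simp add: gauss_cutoff_def normal_density_def)

lemma integral_gauss_cutoff_cis:
  assumes "m > 0"
  shows "(LINT \<xi>|lborel. cis (z * \<xi>) * complex_of_real (gauss_cutoff m \<xi>))
    = complex_of_real (2 * pi * m * std_normal_density (m * z))" (is "?L = _")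
    and "integrable lborel (gauss_cutoff m)"
    and "square_integrable (gauss_cutoff m)"
proof -
  have "?L = m *\<^sub>R (LINT \<xi>|lborel. cis (z * (0 + m * \<xi>)) * complex_of_real (gauss_cutoff m (0 + m * \<xi>)))"
    using lborel_integral_real_affine[of m "\<lambda>\<xi>. cis (z * \<xi>) * complex_of_real (gauss_cutoff m \<xi>)" 0] assms by simp
  also have "(LINT \<xi>|lborel. cis (z * (0 + m * \<xi>)) * complex_of_real (gauss_cutoff m (0 + m * \<xi>)))
     = (LINT \<xi>|lborel. complex_of_real (sqrt (2 * pi)) * (cis ((m * z) * \<xi>) * complex_of_real (std_normal_density \<xi>)))"
    using assms by (intro Bochner_Integration.integral_cong) (auto simp: gauss_cutoff_eq mult_ac)
  also have "\<dots> = complex_of_real (sqrt (2 * pi)) * complex_of_real (exp (- ((m*z)^2) / 2))"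
    by (subst integral_mult_right_zero) (simp only: integral_std_normal_cis)
  also have "m *\<^sub>R \<dots> = complex_of_real (2 * pi * m * std_normal_density (m * z))"
  proof -
    have "sqrt (2 * pi) * sqrt (2 * pi) = 2 * pi" by simp
    then have "m * (sqrt (2 * pi) * exp (- ((m * z)\<^sup>2) / 2)) = 2 * pi * m * std_normal_density (m * z)"
      by (simp add: normal_density_def field_simps del: real_sqrt_mult_self)
    then show ?thesis
      by (simp add: scaleR_conv_of_real flip: of_real_mult)
  qed
  finally show "?L = complex_of_real (2 * pi * m * std_normal_density (m * z))" .
  have "integrable lborel std_normal_density"
    using integrable_std_normal_moment[of 0] by simp
  then have "integrable lborel (\<lambda>\<xi>. std_normal_density (0 + (1/m) * \<xi>))"
    using assms by (subst lborel_integrable_real_affine_iff) auto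
  then show i: "integrable lborel (gauss_cutoff m)"
    using assms by (simp add: gauss_cutoff_eq cong: Bochner_Integration.integrable_cong)
  show "square_integrable (gauss_cutoff m)"
    unfolding square_integrable_def
  proof (intro conjI)
    show "integrable lborel (\<lambda>x. (norm (gauss_cutoff m x))\<^sup>2)"
    proof (rule Bochner_Integration.integrable_bound[OF i])
      show "AE x in lborel. norm ((norm (gauss_cutoff m x))\<^sup>2) \<le> norm (gauss_cutoff m x)"
        by (auto simp: gauss_cutoff_def power2_eq_square mult_le_cancel_left1 intro!: mult_left_le)
    qed auto
  qed auto
qed

text \<open>Fubini, after which the inner integral over \<open>\<xi>\<close> is the Gaussian
  transform at \<open>x - y\<close>. Absolute integrability in \<open>y\<close> comes from the
  truncation to \<open>{-R..R}\<close>, as \<open>f\<close> is only in L^2.\<close>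

lemma integral_truncated_fourier_gauss:
  fixes f :: "real \<Rightarrow> real"
  assumes f: "square_integrable f" and m: "m > 0"
  shows "(LINT \<xi>|lborel. truncated_fourier f R \<xi> * (complex_of_real (gauss_cutoff m \<xi>) * cis (x * \<xi>)))
       = (LINT y|lborel. indicator {-R..R} y *\<^sub>R complex_of_real (f y * (2 * pi * m * std_normal_density (m * (x - y)))))"
    and "integrable lborel (\<lambda>\<xi>. truncated_fourier f R \<xi> * (complex_of_real (gauss_cutoff m \<xi>) * cis (x * \<xi>)))"
proof -
  have [measurable]: "f \<in> borel_measurable borel"
    using f by (simp add: square_integrable_def)
  have fR: "integrable lborel (\<lambda>y. indicator {-R..R} y *\<^sub>R f y)"
    using square_integrable_imp_set_integrable[OF f] by (simp add: set_integrable_def)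
  have gi: "integrable lborel (gauss_cutoff m)"
    by (rule integral_gauss_cutoff_cis[OF m])
  define Q where "Q \<xi> y = (indicator {-R..R} y *\<^sub>R (cis (- (\<xi> * y)) * complex_of_real (f y)))
     * (complex_of_real (gauss_cutoff m \<xi>) * cis (x * \<xi>))" for \<xi> y
  have Qm: "case_prod Q \<in> borel_measurable (lborel \<Otimes>\<^sub>M lborel)"
    unfolding Q_def by measurable
  have nQ: "norm (Q \<xi> y) = gauss_cutoff m \<xi> * \<bar>indicator {-R..R} y *\<^sub>R f y\<bar>" for \<xi> y
    by (simp add: Q_def norm_mult gauss_cutoff_def abs_mult)
  have Q2: "integrable lborel (\<lambda>y. Q \<xi> y)" for \<xi>
  proof (rule integrable_bound_everywhere)
    show "integrable lborel (\<lambda>y. gauss_cutoff m \<xi> * \<bar>indicator {-R..R} y *\<^sub>R f y\<bar>)"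
      by (intro integrable_mult_right integrable_abs fR)
    show "(\<lambda>y. Q \<xi> y) \<in> borel_measurable lborel" unfolding Q_def by measurable
  qed (simp add: nQ)
  have "integrable lborel (\<lambda>\<xi>. LINT y|lborel. norm (case_prod Q (\<xi>, y)))"
    using gi by (simp add: nQ)
  then have Qi: "integrable (lborel \<Otimes>\<^sub>M lborel) (case_prod Q)"
    using Qm Q2 by (intro lborel_pair.Fubini_integrable) auto
  have a: "(LINT y|lborel. Q \<xi> y) = truncated_fourier f R \<xi> * (complex_of_real (gauss_cutoff m \<xi>) * cis (x * \<xi>))" for \<xi>
    unfolding Q_def truncated_fourier_def set_lebesgue_integral_def
    by (rule integral_mult_left_zero)
  have b: "(LINT \<xi>|lborel. Q \<xi> y) = indicator {-R..R} y *\<^sub>R complex_of_real (f y * (2 * pi * m * std_normal_density (m * (x - y))))" for y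
  proof -
    have "Q \<xi> y = (indicator {-R..R} y *\<^sub>R complex_of_real (f y)) * (cis ((x - y) * \<xi>) * complex_of_real (gauss_cutoff m \<xi>))" for \<xi>
    proof -
      have "cis ((x - y) * \<xi>) = cis (- (\<xi> * y)) * cis (x * \<xi>)"
        by (simp add: cis_mult algebra_simps)
      then show ?thesis by (simp add: Q_def mult_ac)
    qed
    then have "(LINT \<xi>|lborel. Q \<xi> y) = (indicator {-R..R} y *\<^sub>R complex_of_real (f y)) *
        (LINT \<xi>|lborel. cis ((x - y) * \<xi>) * complex_of_real (gauss_cutoff m \<xi>))"
      by simp
    then show ?thesis
      by (simp only: integral_gauss_cutoff_cis[OF m]) simp
  qed
  have "(LINT \<xi>|lborel. LINT y|lborel. Q \<xi> y) = (LINT y|lborel. LINT \<xi>|lborel. Q \<xi> y)"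
    using lborel_pair.Fubini_integral[OF Qi] by simp
  then show "(LINT \<xi>|lborel. truncated_fourier f R \<xi> * (complex_of_real (gauss_cutoff m \<xi>) * cis (x * \<xi>)))
       = (LINT y|lborel. indicator {-R..R} y *\<^sub>R complex_of_real (f y * (2 * pi * m * std_normal_density (m * (x - y)))))"
    by (simp only: a b)
  show "integrable lborel (\<lambda>\<xi>. truncated_fourier f R \<xi> * (complex_of_real (gauss_cutoff m \<xi>) * cis (x * \<xi>)))"
    using lborel_pair.integrable_fst[OF Qi] by (simp add: a)
qed

lemma square_integrable_gauss_kernel:
  assumes "m > 0"
  shows "square_integrable (\<lambda>y. c * std_normal_density (m * (x - y)))"
proof -
  have "std_normal_density (m * (x - y)) = gauss_cutoff (1/m) (y - x) / sqrt (2 * pi)" for y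
    using assms by (simp add: gauss_cutoff_def normal_density_def power2_commute power_mult_distrib mult.commute)
  then have *: "(\<lambda>y. c * std_normal_density (m * (x - y))) = (\<lambda>y. c / sqrt (2 * pi) * gauss_cutoff (1/m) (-x + 1 * y))"
    by (auto simp: fun_eq_iff)
  have "integrable lborel (\<lambda>y. (norm (gauss_cutoff (1/m) y))\<^sup>2)"
    using integral_gauss_cutoff_cis(3)[of "1/m"] assms by (simp add: square_integrable_def)
  then have "integrable lborel (\<lambda>y. (norm (gauss_cutoff (1/m) (-x + 1 * y)))\<^sup>2)"
    by (subst lborel_integrable_real_affine_iff) auto
  then show ?thesis
    unfolding * square_integrable_def by (auto simp: power_mult_distrib power_divide)
qed

text \<open>The limit of the truncated identity as \<open>R\<close> tends to infinity. On the left
  the truncated transforms converge in L^2 and are paired with an L^2 function; on the right the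
  kernel is in L^2 as well, so the product with \<open>f\<close> is integrable and dominated
  convergence applies.\<close>

lemma integral_fourier_gauss:
  assumes fF: "has_fourier_transform f F" and m: "m > 0"
  shows "(LINT \<xi>|lborel. F \<xi> * (complex_of_real (gauss_cutoff m \<xi>) * cis (x * \<xi>)))
       = complex_of_real (LINT y|lborel. f y * (2 * pi * m * std_normal_density (m * (x - y))))"
proof -
  have sq: "square_integrable f" "square_integrable F"
    and lim: "((\<lambda>R. \<integral>\<^sup>+ \<xi>. ennreal ((cmod (F \<xi> - truncated_fourier f R \<xi>))\<^sup>2) \<partial>lborel) \<longlongrightarrow> 0) at_top"
    using fF by (auto simp: has_fourier_transform_def)
  then have [measurable]: "f \<in> borel_measurable borel" "F \<in> borel_measurable borel"
    by (auto simp: square_integrable_def)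
  define h where "h \<xi> = complex_of_real (gauss_cutoff m \<xi>) * cis (x * \<xi>)" for \<xi>
  have [measurable]: "h \<in> borel_measurable borel" unfolding h_def by measurable
  have nh: "cmod (h \<xi>) = gauss_cutoff m \<xi>" for \<xi> by (simp add: h_def norm_mult gauss_cutoff_def)
  have sqh: "square_integrable h"
    using integral_gauss_cutoff_cis(3)[OF m] by (simp add: square_integrable_def nh)
  have Fh: "integrable lborel (\<lambda>\<xi>. F \<xi> * h \<xi>)"
    by (rule square_integrable_mult[OF sq(2) sqh])
  have Th: "integrable lborel (\<lambda>\<xi>. truncated_fourier f R \<xi> * h \<xi>)" for R
    using integral_truncated_fourier_gauss(2)[OF sq(1) m] by (simp add: h_def)
  define H where "H = (\<integral>\<^sup>+ \<xi>. ennreal ((cmod (h \<xi>))\<^sup>2) \<partial>lborel)"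
  have H: "H < top"
    using sqh unfolding H_def square_integrable_def
    by (metis (no_types, lifting) integrableD(2) infinity_ennreal_def nn_integral_cong top.not_eq_extremum real_norm_def abs_power2)
  define D where "D R = (LINT \<xi>|lborel. F \<xi> * h \<xi>) - (LINT \<xi>|lborel. truncated_fourier f R \<xi> * h \<xi>)" for R
  \<comment> \<open>Cauchy-Schwarz, with \<open>H\<close> the squared L^2 norm of \<open>h\<close>.
    The summand \<open>0 * 0\<close> only gives the bound the two-term form of
    \<open>tendsto_zero_ennreal_lincomb\<close>.\<close>
  have "ennreal ((cmod (D R))\<^sup>2) \<le> H * (\<integral>\<^sup>+ \<xi>. ennreal ((cmod (F \<xi> - truncated_fourier f R \<xi>))\<^sup>2) \<partial>lborel) + 0 * 0" for R
  proof -
    have i: "integrable lborel (\<lambda>\<xi>. (F \<xi> - truncated_fourier f R \<xi>) * h \<xi>)"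
      using Bochner_Integration.integrable_diff[OF Fh Th[of R]] by (simp add: algebra_simps)
    have "D R = (LINT \<xi>|lborel. (F \<xi> - truncated_fourier f R \<xi>) * h \<xi>)"
      unfolding D_def by (subst Bochner_Integration.integral_diff[OF Fh Th, symmetric]) (simp add: algebra_simps)
    then have "ennreal (cmod (D R)) \<le> (\<integral>\<^sup>+ \<xi>. ennreal (cmod ((F \<xi> - truncated_fourier f R \<xi>) * h \<xi>)) \<partial>lborel)"
      using integral_norm_bound_ennreal[OF i] by simp
    also have "\<dots> = (\<integral>\<^sup>+ \<xi>. ennreal (cmod (F \<xi> - truncated_fourier f R \<xi>)) * ennreal (cmod (h \<xi>)) \<partial>lborel)"
      by (simp add: norm_mult ennreal_mult')
    finally have "(ennreal (cmod (D R)))\<^sup>2 \<le> (\<dots>)\<^sup>2"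
      by (intro power_mono) auto
    also have "\<dots> \<le> (\<integral>\<^sup>+ \<xi>. (ennreal (cmod (F \<xi> - truncated_fourier f R \<xi>)))\<^sup>2 \<partial>lborel) * (\<integral>\<^sup>+ \<xi>. (ennreal (cmod (h \<xi>)))\<^sup>2 \<partial>lborel)"
      by (rule Cauchy_Schwarz_nn_integral) measurable
    finally show ?thesis by (simp add: H_def ennreal_power mult.commute)
  qed
  moreover have "((\<lambda>R. H * (\<integral>\<^sup>+ \<xi>. ennreal ((cmod (F \<xi> - truncated_fourier f R \<xi>))\<^sup>2) \<partial>lborel) + 0 * 0) \<longlongrightarrow> 0) at_top"
    using lim H by (intro tendsto_zero_ennreal_lincomb) auto
  ultimately have "((\<lambda>R. ennreal ((cmod (D R))\<^sup>2)) \<longlongrightarrow> ennreal 0) at_top"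
    using tendsto_zero_ennreal_mono by (metis (no_types, lifting) ennreal_0)
  then have "((\<lambda>R. (cmod (D R))\<^sup>2) \<longlongrightarrow> 0) at_top"
    by (rule tendsto_ennrealD) auto
  then have D0: "(D \<longlongrightarrow> 0) at_top"
    using tendsto_norm_zero_cancel by fastforce
  define k where "k y = complex_of_real (f y * (2 * pi * m * std_normal_density (m * (x - y))))" for y
  have ki: "integrable lborel k"
    using square_integrable_mult[OF sq(1) square_integrable_gauss_kernel[OF m, of "2 * pi * m" x]]
    unfolding k_def by (intro integrable_of_real)
  then have [measurable]: "k \<in> borel_measurable borel" by auto
  have "((\<lambda>R::real. LINT y|lborel. indicator {-R..R} y *\<^sub>R k y) \<longlongrightarrow> (LINT y|lborel. k y)) at_top"
  proof (rule integral_dominated_convergence_at_top[where w = "\<lambda>y. norm (k y)"])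
    show "\<forall>\<^sub>F R in at_top. AE y in lborel. norm (indicator {-R..R::real} y *\<^sub>R k y) \<le> norm (k y)"
      by (intro always_eventually allI AE_I2) (auto simp: indicator_def)
    show "AE y in lborel. ((\<lambda>R. indicator {-R..R::real} y *\<^sub>R k y) \<longlongrightarrow> k y) at_top"
    proof (intro AE_I2 tendsto_eventually)
      fix y
      show "\<forall>\<^sub>F R in at_top. indicator {-R..R} y *\<^sub>R k y = k y"
        using eventually_ge_at_top[of "\<bar>y\<bar>"] by eventually_elim (auto simp: indicator_def)
    qed
  qed (use ki in auto)
  then have "((\<lambda>R. D R + (LINT y|lborel. indicator {-R..R} y *\<^sub>R k y)) \<longlongrightarrow> 0 + (LINT y|lborel. k y)) at_top"
    by (intro tendsto_add D0)
  moreover have "D R + (LINT y|lborel. indicator {-R..R} y *\<^sub>R k y) = (LINT \<xi>|lborel. F \<xi> * h \<xi>)" for R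
    using integral_truncated_fourier_gauss(1)[OF sq(1) m, of R x] by (simp add: D_def h_def k_def)
  ultimately have "(LINT \<xi>|lborel. F \<xi> * h \<xi>) = (LINT y|lborel. k y)"
    by (simp add: tendsto_const_iff)
  then show ?thesis
    unfolding h_def k_def by (simp only: integral_complex_of_real)
qed

text \<open>By \<open>exp y >= 1 + y\<close>, the quotient \<open>exp ((m^2 - 1) z^2 / 2)\<close> of
  the two densities is at least \<open>m^2 / 2\<close>. The tail of every kernel is thus a small
  multiple of one fixed kernel, against which an unbounded L^2 function can still be
  integrated.\<close>

lemma gauss_kernel_decay:
  assumes m: "m \<ge> 1" and z: "\<bar>z\<bar> \<ge> 1"
  shows "m * std_normal_density (m * z) \<le> 2 / m * std_normal_density z"
proof -
  have m2: "1 \<le> m\<^sup>2" and z2: "1 \<le> z\<^sup>2"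
    using m z by (simp_all add: one_le_power abs_le_square_iff[of 1 z, simplified])
  have "m\<^sup>2 / 2 \<le> 1 + (m\<^sup>2 - 1) * 1 / 2"
    by (simp add: field_simps)
  also have "\<dots> \<le> 1 + (m\<^sup>2 - 1) * z\<^sup>2 / 2"
    using m2 z2 by (intro add_left_mono divide_right_mono mult_left_mono) auto
  also have "\<dots> \<le> exp ((m\<^sup>2 - 1) * z\<^sup>2 / 2)"
    by (rule exp_ge_add_one_self)
  finally have "m\<^sup>2 / 2 * std_normal_density (m * z) \<le> exp ((m\<^sup>2 - 1) * z\<^sup>2 / 2) * std_normal_density (m * z)"
    by (rule mult_right_mono) (simp add: normal_density_nonneg)
  also have "\<dots> = std_normal_density z"
    by (simp add: normal_density_def mult_exp_exp field_simps)
  finally show ?thesis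
    using m by (simp add: field_simps power2_eq_square)
qed

text \<open>An approximate identity of mass \<open>2 * pi\<close>, for \<open>f\<close> continuous
  and in L^2 but possibly unbounded. The line is cut at distance 1 from \<open>x\<close>: inside,
  \<open>f\<close> is bounded by compactness and dominated convergence works after rescaling;
  outside, the decay of the kernel gives a bound of order \<open>1 / m\<close>.\<close>

lemma gauss_kernel_tendsto:
  assumes f: "square_integrable f" and cont: "continuous_on UNIV f"
  shows "(\<lambda>k. LINT y|lborel. f y * (2 * pi * real (Suc k) * std_normal_density (real (Suc k) * (x - y))))
     \<longlonglongrightarrow> 2 * pi * f x"
proof -
  have [measurable]: "f \<in> borel_measurable borel"
    using f by (simp add: square_integrable_def)
  let ?m = "\<lambda>k. real (Suc k)"
  let ?K = "\<lambda>k y. f y * (2 * pi * ?m k * std_normal_density (?m k * (x - y)))"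
  define A where "A = {x - 1..x + 1}"
  have [measurable]: "A \<in> sets borel" by (simp add: A_def)
  have Ki: "integrable lborel (?K k)" for k
    by (intro square_integrable_mult[OF f] square_integrable_gauss_kernel) auto
  have Ai: "integrable lborel (\<lambda>y. indicator A y *\<^sub>R ?K k y)" and Bi: "integrable lborel (\<lambda>y. indicator (-A) y *\<^sub>R ?K k y)" for k
    by (intro integrable_mult_indicator Ki; simp)+
  have split: "(LINT y|lborel. ?K k y) = (LINT y|lborel. indicator A y *\<^sub>R ?K k y) + (LINT y|lborel. indicator (-A) y *\<^sub>R ?K k y)" for k
    by (subst Bochner_Integration.integral_add[OF Ai Bi, symmetric]) (auto simp: indicator_def intro!: Bochner_Integration.integral_cong)
  have near: "(\<lambda>k. LINT y|lborel. indicator A y *\<^sub>R ?K k y) \<longlonglongrightarrow> 2 * pi * f x"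
  proof -
    have "compact (f ` A)"
      unfolding A_def by (intro compact_continuous_image continuous_on_subset[OF cont]) auto
    then obtain M where M: "\<And>y. y \<in> A \<Longrightarrow> \<bar>f y\<bar> \<le> M"
      using compact_imp_bounded[THEN bounded_iff[THEN iffD1]] by (metis image_eqI real_norm_def)
    have M0: "0 \<le> M" using M[of x] by (simp add: A_def)
    \<comment> \<open>The substitution \<open>y = x + z / ?m k\<close> fixes the Gaussian and moves
      the concentration into the argument of \<open>f\<close>.\<close>
    have eq: "(LINT y|lborel. indicator A y *\<^sub>R ?K k y)
      = (LINT z|lborel. indicator A (x + z / ?m k) * f (x + z / ?m k) * (2 * pi * std_normal_density z))" for k
    proof -
      have m0: "?m k \<noteq> 0" by simp
      have "(LINT y|lborel. indicator A y *\<^sub>R ?K k y) =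
        \<bar>1 / ?m k\<bar> *\<^sub>R (LINT z|lborel. indicator A (x + 1 / ?m k * z) *\<^sub>R ?K k (x + 1 / ?m k * z))"
        by (rule lborel_integral_real_affine) simp
      also have "\<dots> = (LINT z|lborel. \<bar>1 / ?m k\<bar> * (indicator A (x + 1 / ?m k * z) *\<^sub>R ?K k (x + 1 / ?m k * z)))"
        by (simp only: integral_mult_right_zero real_scaleR_def)
      also have "\<dots> = (LINT z|lborel. indicator A (x + z / ?m k) * f (x + z / ?m k) * (2 * pi * std_normal_density z))"
      proof (rule Bochner_Integration.integral_cong[OF refl])
        fix z
        have "?m k * (x - (x + z / ?m k)) = - z" using m0 by (simp add: field_simps del: of_nat_Suc)
        moreover have "std_normal_density (-z) = std_normal_density z" by (simp add: normal_density_def)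
        ultimately show "\<bar>1 / ?m k\<bar> * (indicator A (x + 1 / ?m k * z) *\<^sub>R ?K k (x + 1 / ?m k * z))
          = indicator A (x + z / ?m k) * f (x + z / ?m k) * (2 * pi * std_normal_density z)"
          using m0 by (simp del: of_nat_Suc)
      qed
      finally show ?thesis .
    qed
    have conv: "(\<lambda>k. x + z / ?m k) \<longlonglongrightarrow> x" for z
      using tendsto_add[OF tendsto_const[of x] tendsto_mult[OF tendsto_const[of z] lim_1_over_n[THEN LIMSEQ_Suc]]]
      by simp
    have "(\<lambda>k. LINT z|lborel. indicator A (x + z / ?m k) * f (x + z / ?m k) * (2 * pi * std_normal_density z))
       \<longlonglongrightarrow> (LINT z|lborel. f x * (2 * pi * std_normal_density z))"
    proof (rule integral_dominated_convergence[where w = "\<lambda>z. M * (2 * pi * std_normal_density z)"])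
      show "integrable lborel (\<lambda>z. M * (2 * pi * std_normal_density z))"
        using integrable_std_normal_moment[of 0] by simp
      show "AE z in lborel. (\<lambda>k. indicator A (x + z / ?m k) * f (x + z / ?m k) * (2 * pi * std_normal_density z))
          \<longlonglongrightarrow> f x * (2 * pi * std_normal_density z)"
      proof (rule AE_I2)
        fix z
        have "(\<lambda>k. f (x + z / ?m k)) \<longlonglongrightarrow> f x"
          using cont by (intro isCont_tendsto_compose[OF _ conv]) (simp add: continuous_on_eq_continuous_at)
        moreover have "\<forall>\<^sub>F k in sequentially. indicator A (x + z / ?m k) = (1::real)"
        proof -
          have "\<forall>\<^sub>F k in sequentially. dist (x + z / ?m k) x < 1"
            using conv[of z] by (rule tendstoD) simp
          then show ?thesis
          proof eventually_elim
            case (elim k)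
            then have "\<bar>z / ?m k\<bar> < 1" by (simp add: dist_real_def del: of_nat_Suc)
            then have "x + z / ?m k \<in> A" unfolding A_def atLeastAtMost_iff by linarith
            then show ?case by (rule indicator_simps(1))
          qed
        qed
        ultimately have "(\<lambda>k. indicator A (x + z / ?m k) * f (x + z / ?m k) * (2 * pi * std_normal_density z))
           \<longlonglongrightarrow> 1 * f x * (2 * pi * std_normal_density z)"
          by (intro tendsto_mult tendsto_const) (auto intro: tendsto_eventually)
        then show "(\<lambda>k. indicator A (x + z / ?m k) * f (x + z / ?m k) * (2 * pi * std_normal_density z))
           \<longlonglongrightarrow> f x * (2 * pi * std_normal_density z)" by simp
      qed
      show "AE z in lborel. norm (indicator A (x + z / ?m k) * f (x + z / ?m k) * (2 * pi * std_normal_density z))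
          \<le> M * (2 * pi * std_normal_density z)" for k
      proof (rule AE_I2)
        fix z
        have "\<bar>indicator A (x + z / ?m k) * f (x + z / ?m k)\<bar> \<le> M"
          using M[of "x + z / ?m k"] M0 by (auto simp: indicator_def split: if_splits)
        then have "\<bar>indicator A (x + z / ?m k) * f (x + z / ?m k)\<bar> * (2 * pi * std_normal_density z) \<le> M * (2 * pi * std_normal_density z)"
          by (rule mult_right_mono) (simp add: normal_density_nonneg)
        then show "norm (indicator A (x + z / ?m k) * f (x + z / ?m k) * (2 * pi * std_normal_density z))
          \<le> M * (2 * pi * std_normal_density z)"
          by (simp add: abs_mult normal_density_nonneg)
      qed
    qed measurable
    moreover have "(LINT z|lborel. f x * (2 * pi * std_normal_density z)) = 2 * pi * f x"
      using integral_std_normal_moment_even[of 0] by simp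
    ultimately show ?thesis by (simp only: eq)
  qed
  have far: "(\<lambda>k. LINT y|lborel. indicator (-A) y *\<^sub>R ?K k y) \<longlonglongrightarrow> 0"
  proof -
    define C where "C = (LINT y|lborel. \<bar>f y * (2 * pi * std_normal_density (1 * (x - y)))\<bar>)"
    have Ci: "integrable lborel (\<lambda>y. \<bar>f y * (2 * pi * std_normal_density (1 * (x - y)))\<bar>)"
      by (intro integrable_abs square_integrable_mult[OF f] square_integrable_gauss_kernel) auto
    have le: "norm (LINT y|lborel. indicator (-A) y *\<^sub>R ?K k y) \<le> 2 * C * (1 / ?m k)" for k
    proof -
      have "norm (LINT y|lborel. indicator (-A) y *\<^sub>R ?K k y) \<le>
          (LINT y|lborel. 2 / ?m k * \<bar>f y * (2 * pi * std_normal_density (1 * (x - y)))\<bar>)"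
      proof (rule Bochner_Integration.integral_norm_bound_integral[OF Bi])
        show "integrable lborel (\<lambda>y. 2 / ?m k * \<bar>f y * (2 * pi * std_normal_density (1 * (x - y)))\<bar>)"
          by (intro integrable_mult_right Ci)
        fix y
        show "norm (indicator (-A) y *\<^sub>R ?K k y) \<le> 2 / ?m k * \<bar>f y * (2 * pi * std_normal_density (1 * (x - y)))\<bar>"
        proof (cases "y \<in> A")
          case False
          then have "1 \<le> \<bar>x - y\<bar>" by (auto simp: A_def)
          then have "?m k * std_normal_density (?m k * (x - y)) \<le> 2 / ?m k * std_normal_density (x - y)"
            by (intro gauss_kernel_decay) auto
          then have "\<bar>f y\<bar> * (2 * pi) * (?m k * std_normal_density (?m k * (x - y)))
             \<le> \<bar>f y\<bar> * (2 * pi) * (2 / ?m k * std_normal_density (x - y))"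
            by (rule mult_left_mono) auto
          then show ?thesis using False
            by (simp add: abs_mult normal_density_nonneg mult_ac del: of_nat_Suc)
        qed auto
      qed
      then show ?thesis by (simp add: C_def del: of_nat_Suc)
    qed
    have "(\<lambda>k. 2 * C * (1 / ?m k)) \<longlonglongrightarrow> 2 * C * 0"
      by (intro tendsto_mult tendsto_const lim_1_over_n[THEN LIMSEQ_Suc])
    then have "(\<lambda>k. 2 * C * (1 / ?m k)) \<longlonglongrightarrow> 0" by simp
    with le show ?thesis
      by (rule Lim_null_comparison[OF always_eventually[OF allI]])
  qed
  show ?thesis
    using tendsto_add[OF near far] by (simp only: split) simp
qed

text \<open>The cutoff identity with \<open>m = Suc k\<close> as \<open>k\<close> grows:
  \<open>|F|\<close> dominates on one side, the approximate identity acts on the other. Continuity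
  of \<open>f\<close> gives the formula at every point; the factor \<open>2 * pi\<close> reflects
  the unnormalised transform.\<close>

theorem fourier_inversion:
  assumes fF: "has_fourier_transform f F" and cont: "continuous_on UNIV f" and Fi: "integrable lborel F"
  shows "complex_of_real (2 * pi * f x) = (LINT \<xi>|lborel. F \<xi> * cis (x * \<xi>))"
proof -
  have [measurable]: "F \<in> borel_measurable borel" using Fi by auto
  have sq: "square_integrable f" using fF by (simp add: has_fourier_transform_def)
  let ?m = "\<lambda>k. real (Suc k)"
  have "(\<lambda>k. LINT \<xi>|lborel. F \<xi> * (complex_of_real (gauss_cutoff (?m k) \<xi>) * cis (x * \<xi>)))
     \<longlonglongrightarrow> (LINT \<xi>|lborel. F \<xi> * cis (x * \<xi>))"
  proof (rule integral_dominated_convergence[where w = "\<lambda>\<xi>. norm (F \<xi>)"])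
    show "AE \<xi> in lborel. (\<lambda>k. F \<xi> * (complex_of_real (gauss_cutoff (?m k) \<xi>) * cis (x * \<xi>))) \<longlonglongrightarrow> F \<xi> * cis (x * \<xi>)"
    proof (rule AE_I2)
      fix \<xi>
      have "(\<lambda>k. \<xi> * (1 / ?m k)) \<longlonglongrightarrow> \<xi> * 0"
        by (intro tendsto_mult tendsto_const lim_1_over_n[THEN LIMSEQ_Suc])
      then have "(\<lambda>k. \<xi> / ?m k) \<longlonglongrightarrow> 0" by simp
      then have "(\<lambda>k. gauss_cutoff (?m k) \<xi>) \<longlonglongrightarrow> exp (- (0\<^sup>2) / 2)"
        unfolding gauss_cutoff_def by (intro tendsto_intros) auto
      then have "(\<lambda>k. F \<xi> * (complex_of_real (gauss_cutoff (?m k) \<xi>) * cis (x * \<xi>))) \<longlonglongrightarrow> F \<xi> * (complex_of_real (exp (- (0\<^sup>2) / 2)) * cis (x * \<xi>))"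
        by (intro tendsto_mult tendsto_const tendsto_of_real)
      then show "(\<lambda>k. F \<xi> * (complex_of_real (gauss_cutoff (?m k) \<xi>) * cis (x * \<xi>))) \<longlonglongrightarrow> F \<xi> * cis (x * \<xi>)"
        by simp
    qed
    show "AE \<xi> in lborel. norm (F \<xi> * (complex_of_real (gauss_cutoff (?m k) \<xi>) * cis (x * \<xi>))) \<le> norm (F \<xi>)" for k
      by (intro AE_I2) (auto simp: norm_mult gauss_cutoff_def intro!: mult_right_le_one_le)
    show "integrable lborel (\<lambda>\<xi>. cmod (F \<xi>))" using Fi by (rule integrable_norm)
  qed measurable
  moreover have "(LINT \<xi>|lborel. F \<xi> * (complex_of_real (gauss_cutoff (?m k) \<xi>) * cis (x * \<xi>)))
    = complex_of_real (LINT y|lborel. f y * (2 * pi * ?m k * std_normal_density (?m k * (x - y))))" for k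
    by (rule integral_fourier_gauss[OF fF]) simp
  moreover have "(\<lambda>k. complex_of_real (LINT y|lborel. f y * (2 * pi * ?m k * std_normal_density (?m k * (x - y)))))
     \<longlonglongrightarrow> complex_of_real (2 * pi * f x)"
    by (intro tendsto_of_real gauss_kernel_tendsto sq cont)
  ultimately show ?thesis
    by (metis (no_types, lifting) LIMSEQ_unique ext)
qed

section \<open>Sobolev embedding\<close>

lemma integrable_japanese_bracket:
  assumes "r > 1 / 2"
  shows "integrable lborel (\<lambda>\<xi>::real. (1 + \<xi>\<^sup>2) powr (- r))"
proof -
  have r: "- (2 * r) < -1" using assms by simp
  have "((\<lambda>x::real. x powr (- (2 * r))) has_integral -(1 powr (- (2 * r) + 1)) / (- (2 * r) + 1)) {1..}"
    by (rule has_integral_powr_to_inf[OF r]) simp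
  then have "(\<lambda>x::real. x powr (- (2 * r))) absolutely_integrable_on {1..}"
    by (intro nonnegative_absolutely_integrable_1) (auto simp: integrable_on_def)
  then have "integrable lebesgue (\<lambda>x. indicator {1..} x *\<^sub>R (x powr (- (2 * r))) :: real)"
    by (simp add: set_integrable_def)
  then have i: "integrable lborel (\<lambda>x. indicator {1..} x *\<^sub>R (x powr (- (2 * r))) :: real)"
    by (subst (asm) integrable_completion) auto
  \<comment> \<open>The reflected copy covers the negative half line; \<open>0 + (-1) * x\<close> is
    the shape that the affine change of variables matches.\<close>
  then have i': "integrable lborel (\<lambda>x. indicator {1..} (0 + (-1) * x) *\<^sub>R ((0 + (-1) * x) powr (- (2 * r))) :: real)"
    by (subst lborel_integrable_real_affine_iff) auto
  have i0: "integrable lborel (indicator {-1..1} :: real \<Rightarrow> real)"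
    by (simp add: emeasure_lborel_Icc_eq)
  show ?thesis
  proof (rule integrable_bound_everywhere)
    show "integrable lborel (\<lambda>x. indicator {-1..1} x + indicator {1..} x *\<^sub>R (x powr (- (2 * r)))
         + indicator {1..} (0 + (-1) * x) *\<^sub>R ((0 + (-1) * x) powr (- (2 * r))) :: real)"
      by (intro Bochner_Integration.integrable_add i i' i0)
    fix x :: real
    have eq: "(1 + x\<^sup>2) powr (- r) = 1 / (1 + x\<^sup>2) powr r" by (simp add: powr_minus_divide)
    have "(1 + x\<^sup>2) powr (- r) \<le> 1"
      unfolding eq using assms by (auto simp: divide_le_eq intro!: ge_one_powr_ge_zero)
    moreover have "(1 + x\<^sup>2) powr (- r) \<le> \<bar>x\<bar> powr (- (2 * r))" if "\<bar>x\<bar> \<ge> 1"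
    proof -
      have "(1 + x\<^sup>2) powr (- r) \<le> (\<bar>x\<bar>\<^sup>2) powr (- r)"
        using that assms by (intro powr_mono2') auto
      also have "\<dots> = \<bar>x\<bar> powr (- (2 * r))"
      proof -
        have "\<bar>x\<bar>\<^sup>2 = \<bar>x\<bar> powr 2" using that by (simp add: powr_numeral del: power2_abs)
        then show ?thesis by (simp only: powr_powr) simp
      qed
      finally show ?thesis .
    qed
    ultimately show "norm ((1 + x\<^sup>2) powr (- r)) \<le> indicator {-1..1} x + indicator {1..} x *\<^sub>R (x powr (- (2 * r)))
         + indicator {1..} (0 + (-1) * x) *\<^sub>R ((0 + (-1) * x) powr (- (2 * r)))"
      by (cases "x \<le> -1"; cases "x \<ge> 1") (auto simp: indicator_def)
  qed measurable
qed

lemma cauchy_schwarz_integral: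
  fixes f g :: "'a \<Rightarrow> real"
  assumes "integrable M (\<lambda>x. (f x)\<^sup>2)" "integrable M (\<lambda>x. (g x)\<^sup>2)" and [measurable]: "f \<in> borel_measurable M" "g \<in> borel_measurable M"
    and nonneg: "\<And>x. 0 \<le> f x" "\<And>x. 0 \<le> g x"
  shows "integrable M (\<lambda>x. f x * g x)"
    and "(LINT x|M. f x * g x) \<le> sqrt (LINT x|M. (f x)\<^sup>2) * sqrt (LINT x|M. (g x)\<^sup>2)"
proof -
  have "integrable M (\<lambda>x. (f x)\<^sup>2 + (g x)\<^sup>2)"
    using assms(1,2) by (rule Bochner_Integration.integrable_add)
  then show i: "integrable M (\<lambda>x. f x * g x)"
  proof (rule integrable_bound_everywhere[rotated])
    fix x
    show "norm (f x * g x) \<le> (f x)\<^sup>2 + (g x)\<^sup>2"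
      using sum_squares_bound[of "f x" "g x"] mult_nonneg_nonneg[OF nonneg(1)[of x] nonneg(2)[of x]]
      unfolding real_norm_def by linarith
  qed measurable
  have "(\<integral>\<^sup>+x. ennreal (f x) * ennreal (g x) \<partial>M)\<^sup>2 \<le> (\<integral>\<^sup>+x. (ennreal (f x))\<^sup>2 \<partial>M) * (\<integral>\<^sup>+x. (ennreal (g x))\<^sup>2 \<partial>M)"
    by (rule Cauchy_Schwarz_nn_integral) measurable
  also have "\<dots> = ennreal (LINT x|M. (f x)\<^sup>2) * ennreal (LINT x|M. (g x)\<^sup>2)"
    using nonneg assms(1,2) by (simp add: ennreal_power nn_integral_eq_integral)
  also have "(\<integral>\<^sup>+x. ennreal (f x) * ennreal (g x) \<partial>M) = ennreal (LINT x|M. f x * g x)"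
    using nonneg i by (simp add: nn_integral_eq_integral flip: ennreal_mult')
  finally have "ennreal ((LINT x|M. f x * g x)\<^sup>2) \<le> ennreal ((LINT x|M. (f x)\<^sup>2) * (LINT x|M. (g x)\<^sup>2))"
    using nonneg by (simp add: ennreal_power ennreal_mult' integral_nonneg)
  then have "(LINT x|M. f x * g x)\<^sup>2 \<le> (LINT x|M. (f x)\<^sup>2) * (LINT x|M. (g x)\<^sup>2)"
    by (subst (asm) ennreal_le_iff) (auto intro!: mult_nonneg_nonneg integral_nonneg)
  then have "sqrt ((LINT x|M. f x * g x)\<^sup>2) \<le> sqrt ((LINT x|M. (f x)\<^sup>2) * (LINT x|M. (g x)\<^sup>2))"
    by (rule real_sqrt_le_mono)
  then show "(LINT x|M. f x * g x) \<le> sqrt (LINT x|M. (f x)\<^sup>2) * sqrt (LINT x|M. (g x)\<^sup>2)"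
    by (simp add: real_sqrt_mult)
qed

text \<open>\<open>sobolev_norm\<close> evaluates a transform picked by \<open>SOME\<close>, whereas
  membership in \<open>sobolev r\<close> speaks of some transform. Uniqueness almost everywhere
  carries the weighted integrability over, so that a single \<open>F\<close> serves both.\<close>

lemma sobolev_transform:
  assumes "f \<in> sobolev r"
  obtains F where "has_fourier_transform f F" "integrable lborel (\<lambda>\<xi>. (1 + \<xi>\<^sup>2) powr r * (cmod (F \<xi>))\<^sup>2)"
    "sobolev_norm r f = sqrt (LINT \<xi>|lborel. (1 + \<xi>\<^sup>2) powr r * (cmod (F \<xi>))\<^sup>2)"
proof -
  obtain G where G: "has_fourier_transform f G" "integrable lborel (\<lambda>\<xi>. (1 + \<xi>\<^sup>2) powr r * (cmod (G \<xi>))\<^sup>2)"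
    using assms by (auto simp: sobolev_def)
  define F where "F = (SOME F. has_fourier_transform f F)"
  have F: "has_fourier_transform f F" unfolding F_def by (rule someI[where P = "has_fourier_transform f", OF G(1)])
  have [measurable]: "F \<in> borel_measurable borel" "G \<in> borel_measurable borel"
    using F G by (auto simp: has_fourier_transform_def square_integrable_def)
  have "AE \<xi> in lborel. (1 + \<xi>\<^sup>2) powr r * (cmod (G \<xi>))\<^sup>2 = (1 + \<xi>\<^sup>2) powr r * (cmod (F \<xi>))\<^sup>2"
    using has_fourier_transform_unique[OF F G(1)] by eventually_elim simp
  then have "integrable lborel (\<lambda>\<xi>. (1 + \<xi>\<^sup>2) powr r * (cmod (F \<xi>))\<^sup>2)"
    using G(2) by (subst (asm) integrable_cong_AE) auto
  with F show ?thesis by (intro that) (auto simp: sobolev_norm_def F_def)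
qed

lemma sobolev_lincomb:
  assumes "f \<in> sobolev r" "g \<in> sobolev r"
  shows "(\<lambda>x. a * f x + b * g x) \<in> sobolev r"
proof -
  obtain F G where F: "has_fourier_transform f F" "integrable lborel (\<lambda>\<xi>. (1 + \<xi>\<^sup>2) powr r * (cmod (F \<xi>))\<^sup>2)"
    and G: "has_fourier_transform g G" "integrable lborel (\<lambda>\<xi>. (1 + \<xi>\<^sup>2) powr r * (cmod (G \<xi>))\<^sup>2)"
    using assms by (auto simp: sobolev_def)
  have [measurable]: "F \<in> borel_measurable borel" "G \<in> borel_measurable borel"
    using F G by (auto simp: has_fourier_transform_def square_integrable_def)
  let ?w = "\<lambda>\<xi>::real. (1 + \<xi>\<^sup>2) powr r"
  have "integrable lborel (\<lambda>\<xi>. ?w \<xi> * (cmod (complex_of_real a * F \<xi> + complex_of_real b * G \<xi>))\<^sup>2)"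
  proof (rule integrable_bound_everywhere)
    show "integrable lborel (\<lambda>\<xi>. 2 * a\<^sup>2 * (?w \<xi> * (cmod (F \<xi>))\<^sup>2) + 2 * b\<^sup>2 * (?w \<xi> * (cmod (G \<xi>))\<^sup>2))"
      by (intro Bochner_Integration.integrable_add integrable_mult_right F G)
    fix \<xi>
    have "(cmod (complex_of_real a * F \<xi> + complex_of_real b * G \<xi>))\<^sup>2 \<le> (cmod (complex_of_real a * F \<xi>) + cmod (complex_of_real b * G \<xi>))\<^sup>2"
      by (intro power_mono norm_triangle_ineq) auto
    also have "\<dots> \<le> 2 * (cmod (complex_of_real a * F \<xi>))\<^sup>2 + 2 * (cmod (complex_of_real b * G \<xi>))\<^sup>2"
      using sum_squares_bound[of "cmod (complex_of_real a * F \<xi>)" "cmod (complex_of_real b * G \<xi>)"]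
      by (simp add: power2_sum)
    also have "\<dots> = 2 * a\<^sup>2 * (cmod (F \<xi>))\<^sup>2 + 2 * b\<^sup>2 * (cmod (G \<xi>))\<^sup>2"
      by (simp add: norm_mult power_mult_distrib)
    finally have "?w \<xi> * (cmod (complex_of_real a * F \<xi> + complex_of_real b * G \<xi>))\<^sup>2 \<le>
       ?w \<xi> * (2 * a\<^sup>2 * (cmod (F \<xi>))\<^sup>2 + 2 * b\<^sup>2 * (cmod (G \<xi>))\<^sup>2)"
      by (rule mult_left_mono) simp
    then show "norm (?w \<xi> * (cmod (complex_of_real a * F \<xi> + complex_of_real b * G \<xi>))\<^sup>2) \<le>
       2 * a\<^sup>2 * (?w \<xi> * (cmod (F \<xi>))\<^sup>2) + 2 * b\<^sup>2 * (?w \<xi> * (cmod (G \<xi>))\<^sup>2)"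
      by (simp add: algebra_simps)
  qed measurable
  with has_fourier_transform_lincomb[OF F(1) G(1), of a b] show ?thesis
    unfolding sobolev_def by blast
qed

lemma sobolev_mono:
  assumes "r \<le> s"
  shows "sobolev s \<subseteq> sobolev r"
proof
  fix f assume "f \<in> sobolev s"
  then obtain F where F: "has_fourier_transform f F" "integrable lborel (\<lambda>\<xi>. (1 + \<xi>\<^sup>2) powr s * (cmod (F \<xi>))\<^sup>2)"
    by (auto simp: sobolev_def)
  have [measurable]: "F \<in> borel_measurable borel"
    using F by (auto simp: has_fourier_transform_def square_integrable_def)
  have "integrable lborel (\<lambda>\<xi>. (1 + \<xi>\<^sup>2) powr r * (cmod (F \<xi>))\<^sup>2)"
    by (rule integrable_bound_everywhere[OF _ F(2)]) (auto intro!: mult_right_mono powr_mono assms)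
  with F(1) show "f \<in> sobolev r" by (auto simp: sobolev_def)
qed

text \<open>The L^2 norm of \<open>(1 + \<xi>^2)^(-r/2)\<close>, which is the constant in the
  embedding of \<open>H^r\<close> into the bounded functions. It is meaningful for
  \<open>r > 1/2\<close>; otherwise the integral takes its default value 0.\<close>

definition "bracket_const r = sqrt (LINT \<xi>|lborel. (1 + \<xi>\<^sup>2) powr (- r))"

text \<open>Cauchy-Schwarz for the factorisation of \<open>|F|\<close> into
  \<open>(1 + \<xi>^2)^(-r/2)\<close> and \<open>(1 + \<xi>^2)^(r/2) |F|\<close>.\<close>

lemma weighted_integral_bound:
  fixes F :: "real \<Rightarrow> complex"
  assumes r: "r > 1 / 2" and [measurable]: "F \<in> borel_measurable borel"
    and i: "integrable lborel (\<lambda>\<xi>. (1 + \<xi>\<^sup>2) powr r * (cmod (F \<xi>))\<^sup>2)"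
  shows "integrable lborel F"
    and "(LINT \<xi>|lborel. cmod (F \<xi>)) \<le> bracket_const r * sqrt (LINT \<xi>|lborel. (1 + \<xi>\<^sup>2) powr r * (cmod (F \<xi>))\<^sup>2)"
proof -
  let ?f = "\<lambda>\<xi>::real. (1 + \<xi>\<^sup>2) powr (- r / 2)" and ?g = "\<lambda>\<xi>. (1 + \<xi>\<^sup>2) powr (r / 2) * cmod (F \<xi>)"
  have pos: "0 < 1 + \<xi>\<^sup>2" for \<xi> :: real by (simp add: add_pos_nonneg)
  have sq: "((1 + \<xi>\<^sup>2) powr e)\<^sup>2 = (1 + \<xi>\<^sup>2) powr (2 * e)" for \<xi> e :: real
    by (simp add: power2_eq_square flip: powr_add)
  have f2: "(\<lambda>\<xi>. (?f \<xi>)\<^sup>2) = (\<lambda>\<xi>. (1 + \<xi>\<^sup>2) powr (- r))" by (simp add: sq)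
  have g2: "(\<lambda>\<xi>. (?g \<xi>)\<^sup>2) = (\<lambda>\<xi>. (1 + \<xi>\<^sup>2) powr r * (cmod (F \<xi>))\<^sup>2)" by (simp add: sq power_mult_distrib)
  have fg: "(\<lambda>\<xi>. ?f \<xi> * ?g \<xi>) = (\<lambda>\<xi>. cmod (F \<xi>))"
  proof
    fix \<xi>
    have "?f \<xi> * (1 + \<xi>\<^sup>2) powr (r / 2) = 1" using pos[of \<xi>] by (simp flip: powr_add)
    then show "?f \<xi> * ?g \<xi> = cmod (F \<xi>)" by (simp add: mult.assoc[symmetric])
  qed
  have 1: "integrable lborel (\<lambda>\<xi>. (?f \<xi>)\<^sup>2)" unfolding f2 by (rule integrable_japanese_bracket[OF r])
  have 2: "integrable lborel (\<lambda>\<xi>. (?g \<xi>)\<^sup>2)" unfolding g2 by (rule i)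
  note cs = cauchy_schwarz_integral[OF 1 2]
  have "integrable lborel (\<lambda>\<xi>. cmod (F \<xi>))"
    unfolding fg[symmetric] by (rule cs(1)) auto
  then show "integrable lborel F" by (subst (asm) integrable_norm_iff) auto
  have "(LINT \<xi>|lborel. ?f \<xi> * ?g \<xi>) \<le> sqrt (LINT \<xi>|lborel. (?f \<xi>)\<^sup>2) * sqrt (LINT \<xi>|lborel. (?g \<xi>)\<^sup>2)"
    by (rule cs(2)) auto
  then show "(LINT \<xi>|lborel. cmod (F \<xi>)) \<le> bracket_const r * sqrt (LINT \<xi>|lborel. (1 + \<xi>\<^sup>2) powr r * (cmod (F \<xi>))\<^sup>2)"
    unfolding fg f2 g2 bracket_const_def .
qed

lemma fourier_inversion_Re:
  assumes "has_fourier_transform f F" "continuous_on UNIV f" "integrable lborel F"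
  shows "2 * pi * f x = Re (LINT \<xi>|lborel. F \<xi> * cis (x * \<xi>))"
  by (metis Re_complex_of_real fourier_inversion[OF assms])

lemma abs_integral_cis_le:
  assumes "integrable lborel G"
  shows "\<bar>Re (LINT \<xi>|lborel. G \<xi> * cis (x * \<xi>))\<bar> \<le> (LINT \<xi>|lborel. cmod (G \<xi>))"
proof -
  have "\<bar>Re (LINT \<xi>|lborel. G \<xi> * cis (x * \<xi>))\<bar> \<le> cmod (LINT \<xi>|lborel. G \<xi> * cis (x * \<xi>))"
    by (rule abs_Re_le_cmod)
  also have "\<dots> \<le> (LINT \<xi>|lborel. norm (G \<xi> * cis (x * \<xi>)))"
    by (rule integral_norm_bound)
  also have "\<dots> = (LINT \<xi>|lborel. cmod (G \<xi>))" by (simp add: norm_mult)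
  finally show ?thesis .
qed

theorem sobolev_sup_bound:
  assumes r: "r > 1 / 2" and f: "f \<in> sobolev r" "continuous_on UNIV f"
  shows "\<bar>f x\<bar> \<le> bracket_const r * sobolev_norm r f"
proof -
  obtain F where F: "has_fourier_transform f F" "integrable lborel (\<lambda>\<xi>. (1 + \<xi>\<^sup>2) powr r * (cmod (F \<xi>))\<^sup>2)"
    "sobolev_norm r f = sqrt (LINT \<xi>|lborel. (1 + \<xi>\<^sup>2) powr r * (cmod (F \<xi>))\<^sup>2)"
    using sobolev_transform[OF f(1)] .
  have [measurable]: "F \<in> borel_measurable borel"
    using F by (auto simp: has_fourier_transform_def square_integrable_def)
  note w = weighted_integral_bound[OF r _ F(2)]
  \<comment> \<open>The factor \<open>2 * pi\<close> of the inversion formula is given away, so that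
    the constant is \<open>bracket_const r\<close> itself.\<close>
  have "1 * \<bar>f x\<bar> \<le> 2 * pi * \<bar>f x\<bar>"
    using pi_gt3 by (intro mult_right_mono) auto
  also have "\<dots> = \<bar>Re (LINT \<xi>|lborel. F \<xi> * cis (x * \<xi>))\<bar>"
    by (subst fourier_inversion_Re[OF F(1) f(2) w(1), symmetric]) (auto simp: abs_mult)
  also have "\<dots> \<le> (LINT \<xi>|lborel. cmod (F \<xi>))"
    by (rule abs_integral_cis_le[OF w(1)]) simp
  also have "\<dots> \<le> bracket_const r * sobolev_norm r f"
    unfolding F(3) by (rule w(2)) simp
  finally show ?thesis by simp
qed

section \<open>Differentiation under the Fourier integral\<close>

lemma cmod_cis_diff_le: "cmod (cis a - cis b) \<le> \<bar>a - b\<bar>"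
proof -
  have "norm (cis a - cis b) \<le> 1 * norm (a - b)"
  proof (rule differentiable_bound[where S = UNIV and f' = "\<lambda>t h. h *\<^sub>R (\<i> * cis t)"])
    show "(cis has_derivative (\<lambda>h. h *\<^sub>R (\<i> * cis t))) (at t within UNIV)" for t
      by (auto intro!: derivative_eq_intros simp: scaleR_conv_of_real algebra_simps)
    show "onorm (\<lambda>h::real. h *\<^sub>R (\<i> * cis t)) \<le> 1" for t
      by (rule onorm_le) (simp add: norm_mult)
  qed auto
  then show ?thesis by simp
qed

text \<open>Puts the derivative into the form of a limit at 0, which can be tested along sequences
  as dominated convergence requires.\<close>

lemma has_vector_derivative_iff_quotient:
  "(f has_vector_derivative D) (at x) \<longleftrightarrow> ((\<lambda>h. (f (x + h) - f x) /\<^sub>R h) \<longlongrightarrow> D) (at 0)"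
proof -
  have "norm ((f (x + h) - f x) /\<^sub>R h - D) = norm (f (x + h) - f x - h *\<^sub>R D) / norm h" if "h \<noteq> 0" for h
  proof -
    have "(f (x + h) - f x) /\<^sub>R h - D = (f (x + h) - f x - h *\<^sub>R D) /\<^sub>R h"
      using that by (simp add: scaleR_diff_right)
    then show ?thesis by (simp only: norm_scaleR norm_inverse) (simp add: divide_inverse mult.commute)
  qed
  then have "((\<lambda>h. norm ((f (x + h) - f x) /\<^sub>R h - D)) \<longlongrightarrow> 0) (at 0)
      \<longleftrightarrow> ((\<lambda>h. norm (f (x + h) - f x - h *\<^sub>R D) / norm h) \<longlongrightarrow> 0) (at 0)"
    by (intro filterlim_cong refl) (simp add: eventually_at_filter)
  then show ?thesis
    unfolding has_vector_derivative_def has_derivative_at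
    by (subst (2) LIM_zero_iff[symmetric]) (simp add: tendsto_norm_zero_iff bounded_linear_scaleR_left)
qed

text \<open>The difference quotients of \<open>cis (x * \<xi>)\<close> in \<open>x\<close> have
  modulus at most \<open>|\<xi>|\<close>, so \<open>|\<xi> F|\<close> dominates.\<close>

lemma integral_cis_deriv:
  assumes F: "integrable lborel F" and F1: "integrable lborel (\<lambda>\<xi>. complex_of_real \<xi> * F \<xi>)"
  shows "((\<lambda>x. LINT \<xi>|lborel. F \<xi> * cis (x * \<xi>)) has_vector_derivative
     (LINT \<xi>|lborel. \<i> * (complex_of_real \<xi> * F \<xi>) * cis (x * \<xi>))) (at x)"
proof -
  have [measurable]: "F \<in> borel_measurable borel" using F by auto
  let ?I = "\<lambda>x. LINT \<xi>|lborel. F \<xi> * cis (x * \<xi>)"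
  have Fi: "integrable lborel (\<lambda>\<xi>. F \<xi> * cis (x * \<xi>))" for x
    by (rule integrable_bound_everywhere[OF _ integrable_norm[OF F]]) (auto simp: norm_mult)
  have "((\<lambda>h. (?I (x + h) - ?I x) /\<^sub>R h) \<longlongrightarrow> (LINT \<xi>|lborel. \<i> * (complex_of_real \<xi> * F \<xi>) * cis (x * \<xi>))) (at 0)"
    unfolding tendsto_at_iff_sequentially comp_def
  proof (intro allI impI)
    fix X :: "nat \<Rightarrow> real" assume X: "\<forall>i. X i \<in> UNIV - {0}" and X0: "X \<longlonglongrightarrow> 0"
    have "(\<lambda>i. LINT \<xi>|lborel. F \<xi> * ((cis ((x + X i) * \<xi>) - cis (x * \<xi>)) /\<^sub>R X i))
       \<longlonglongrightarrow> (LINT \<xi>|lborel. \<i> * (complex_of_real \<xi> * F \<xi>) * cis (x * \<xi>))"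
    proof (rule integral_dominated_convergence[where w = "\<lambda>\<xi>. cmod (complex_of_real \<xi> * F \<xi>)"])
      show "integrable lborel (\<lambda>\<xi>. cmod (complex_of_real \<xi> * F \<xi>))" using F1 by (rule integrable_norm)
      show "AE \<xi> in lborel. (\<lambda>i. F \<xi> * ((cis ((x + X i) * \<xi>) - cis (x * \<xi>)) /\<^sub>R X i)) \<longlonglongrightarrow> \<i> * (complex_of_real \<xi> * F \<xi>) * cis (x * \<xi>)"
      proof (rule AE_I2)
        fix \<xi> :: real
        have "((\<lambda>x. cis (x * \<xi>)) has_vector_derivative \<i> * complex_of_real \<xi> * cis (x * \<xi>)) (at x)"
          unfolding has_vector_derivative_def
          by (auto intro!: derivative_eq_intros simp: scaleR_conv_of_real algebra_simps)
        then have "((\<lambda>h. (cis ((x + h) * \<xi>) - cis (x * \<xi>)) /\<^sub>R h) \<longlongrightarrow> \<i> * complex_of_real \<xi> * cis (x * \<xi>)) (at 0)"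
          by (simp only: has_vector_derivative_iff_quotient)
        then have "(\<lambda>i. (cis ((x + X i) * \<xi>) - cis (x * \<xi>)) /\<^sub>R X i) \<longlonglongrightarrow> \<i> * complex_of_real \<xi> * cis (x * \<xi>)"
          unfolding tendsto_at_iff_sequentially comp_def using X X0 by blast
        then have "(\<lambda>i. F \<xi> * ((cis ((x + X i) * \<xi>) - cis (x * \<xi>)) /\<^sub>R X i)) \<longlonglongrightarrow> F \<xi> * (\<i> * complex_of_real \<xi> * cis (x * \<xi>))"
          by (intro tendsto_mult tendsto_const)
        then show "(\<lambda>i. F \<xi> * ((cis ((x + X i) * \<xi>) - cis (x * \<xi>)) /\<^sub>R X i)) \<longlonglongrightarrow> \<i> * (complex_of_real \<xi> * F \<xi>) * cis (x * \<xi>)"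
          by (simp only: mult_ac)
      qed
      show "AE \<xi> in lborel. norm (F \<xi> * ((cis ((x + X i) * \<xi>) - cis (x * \<xi>)) /\<^sub>R X i)) \<le> cmod (complex_of_real \<xi> * F \<xi>)" for i
      proof (rule AE_I2)
        fix \<xi> :: real
        have "X i \<noteq> 0" using X by auto
        have "cmod (cis ((x + X i) * \<xi>) - cis (x * \<xi>)) \<le> \<bar>X i * \<xi>\<bar>"
          using cmod_cis_diff_le[of "(x + X i) * \<xi>" "x * \<xi>"] by (simp add: algebra_simps)
        then have "cmod ((cis ((x + X i) * \<xi>) - cis (x * \<xi>)) /\<^sub>R X i) \<le> \<bar>\<xi>\<bar>"
          unfolding norm_scaleR using \<open>X i \<noteq> 0\<close> by (simp add: field_simps abs_mult)
        then have "cmod (F \<xi>) * cmod ((cis ((x + X i) * \<xi>) - cis (x * \<xi>)) /\<^sub>R X i) \<le> cmod (F \<xi>) * \<bar>\<xi>\<bar>"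
          by (rule mult_left_mono) simp
        then show "norm (F \<xi> * ((cis ((x + X i) * \<xi>) - cis (x * \<xi>)) /\<^sub>R X i)) \<le> cmod (complex_of_real \<xi> * F \<xi>)"
          by (simp add: norm_mult mult_ac)
      qed
    qed measurable
    moreover have "(LINT \<xi>|lborel. F \<xi> * ((cis ((x + X i) * \<xi>) - cis (x * \<xi>)) /\<^sub>R X i)) = (?I (x + X i) - ?I x) /\<^sub>R X i" for i
    proof -
      have "(LINT \<xi>|lborel. F \<xi> * ((cis ((x + X i) * \<xi>) - cis (x * \<xi>)) /\<^sub>R X i))
         = (LINT \<xi>|lborel. (F \<xi> * cis ((x + X i) * \<xi>) - F \<xi> * cis (x * \<xi>)) /\<^sub>R X i)"
        by (simp only: mult_scaleR_right right_diff_distrib)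
      also have "\<dots> = (LINT \<xi>|lborel. F \<xi> * cis ((x + X i) * \<xi>) - F \<xi> * cis (x * \<xi>)) /\<^sub>R X i"
        by (rule integral_scaleR_right)
      also have "\<dots> = (?I (x + X i) - ?I x) /\<^sub>R X i"
        by (simp only: Bochner_Integration.integral_diff[OF Fi Fi])
      finally show ?thesis .
    qed
    ultimately show "(\<lambda>i. (?I (x + X i) - ?I x) /\<^sub>R X i) \<longlonglongrightarrow> (LINT \<xi>|lborel. \<i> * (complex_of_real \<xi> * F \<xi>) * cis (x * \<xi>))"
      by (simp only:)
  qed
  then show ?thesis
    by (simp only: has_vector_derivative_iff_quotient)
qed

lemma continuous_integral_cis:
  assumes G: "integrable lborel G"
  shows "continuous_on UNIV (\<lambda>x. LINT \<xi>|lborel. G \<xi> * cis (x * \<xi>))"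
proof -
  have [measurable]: "G \<in> borel_measurable borel" using G by auto
  show ?thesis
    unfolding continuous_on_sequentially comp_def
  proof (intro allI ballI impI)
    fix X :: "nat \<Rightarrow> real" and a assume "a \<in> UNIV" and X: "(\<forall>n. X n \<in> UNIV) \<and> X \<longlonglongrightarrow> a"
    show "(\<lambda>n. LINT \<xi>|lborel. G \<xi> * cis (X n * \<xi>)) \<longlonglongrightarrow> (LINT \<xi>|lborel. G \<xi> * cis (a * \<xi>))"
    proof (rule integral_dominated_convergence[where w = "\<lambda>\<xi>. cmod (G \<xi>)"])
      show "integrable lborel (\<lambda>\<xi>. cmod (G \<xi>))" using G by (rule integrable_norm)
      show "AE \<xi> in lborel. (\<lambda>n. G \<xi> * cis (X n * \<xi>)) \<longlonglongrightarrow> G \<xi> * cis (a * \<xi>)"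
        using X by (intro AE_I2 tendsto_intros) auto
      show "AE \<xi> in lborel. norm (G \<xi> * cis (X n * \<xi>)) \<le> cmod (G \<xi>)" for n
        by (simp add: norm_mult)
    qed measurable
  qed
qed

text \<open>A derivative costs one power of \<open>\<xi>\<close>: as
  \<open>\<xi>^2 <= 1 + \<xi>^2\<close>, the function \<open>\<xi> F\<close> satisfies the weighted
  condition with exponent \<open>r - 1 > 1/2\<close>. It is therefore integrable, and the inversion
  integral may be differentiated once.\<close>

theorem sobolev_C1:
  assumes r: "r > 3 / 2" and f: "f \<in> sobolev r" "continuous_on UNIV f"
  shows "(f has_real_derivative deriv f x) (at x)"
    and "continuous_on UNIV (deriv f)"
    and "\<bar>deriv f x\<bar> \<le> bracket_const (r - 1) * sobolev_norm r f"
proof -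
  obtain F where F: "has_fourier_transform f F" "integrable lborel (\<lambda>\<xi>. (1 + \<xi>\<^sup>2) powr r * (cmod (F \<xi>))\<^sup>2)"
    "sobolev_norm r f = sqrt (LINT \<xi>|lborel. (1 + \<xi>\<^sup>2) powr r * (cmod (F \<xi>))\<^sup>2)"
    using sobolev_transform[OF f(1)] .
  have [measurable]: "F \<in> borel_measurable borel"
    using F by (auto simp: has_fourier_transform_def square_integrable_def)
  have Fi: "integrable lborel F"
    using r by (intro weighted_integral_bound(1)[OF _ _ F(2)]) auto
  let ?G = "\<lambda>\<xi>. complex_of_real \<xi> * F \<xi>"
  let ?H = "\<lambda>\<xi>. \<i> * ?G \<xi>"
  have le: "(1 + \<xi>\<^sup>2) powr (r - 1) * (cmod (?G \<xi>))\<^sup>2 \<le> (1 + \<xi>\<^sup>2) powr r * (cmod (F \<xi>))\<^sup>2" for \<xi>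
  proof -
    have pos: "0 < 1 + \<xi>\<^sup>2" by (simp add: add_pos_nonneg)
    have "(1 + \<xi>\<^sup>2) powr (r - 1) * \<xi>\<^sup>2 \<le> (1 + \<xi>\<^sup>2) powr (r - 1) * (1 + \<xi>\<^sup>2)"
      by (intro mult_left_mono) auto
    also have "\<dots> = (1 + \<xi>\<^sup>2) powr r"
      using pos by (simp add: powr_diff)
    finally have "(1 + \<xi>\<^sup>2) powr (r - 1) * \<xi>\<^sup>2 * (cmod (F \<xi>))\<^sup>2 \<le> (1 + \<xi>\<^sup>2) powr r * (cmod (F \<xi>))\<^sup>2"
      by (rule mult_right_mono) simp
    then show ?thesis by (simp add: norm_mult power_mult_distrib mult_ac)
  qed
  have i: "integrable lborel (\<lambda>\<xi>. (1 + \<xi>\<^sup>2) powr (r - 1) * (cmod (?G \<xi>))\<^sup>2)"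
    by (rule integrable_bound_everywhere[OF _ F(2)]) (use le in auto)
  have r': "r - 1 > 1 / 2" using r by simp
  note w = weighted_integral_bound[OF r' _ i]
  have Gi: "integrable lborel ?G" by (rule w(1)) measurable
  then have Hi: "integrable lborel ?H" by (rule integrable_mult_right)
  have eq: "f = (\<lambda>x. Re (LINT \<xi>|lborel. F \<xi> * cis (x * \<xi>)) / (2 * pi))"
    using fourier_inversion_Re[OF F(1) f(2) Fi] by (auto simp: field_simps)
  have d: "(f has_real_derivative Re (LINT \<xi>|lborel. ?H \<xi> * cis (x * \<xi>)) / (2 * pi)) (at x)" for x
    unfolding eq has_real_derivative_iff_has_vector_derivative
    using bounded_linear.has_vector_derivative[OF bounded_linear_Re integral_cis_deriv[OF Fi Gi, of x]]
    by (auto simp: has_real_derivative_iff_has_vector_derivative[symmetric] intro: DERIV_cdivide)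
  have deq: "deriv f = (\<lambda>x. Re (LINT \<xi>|lborel. ?H \<xi> * cis (x * \<xi>)) / (2 * pi))"
    by (intro ext DERIV_imp_deriv d)
  show "(f has_real_derivative deriv f x) (at x)" unfolding deq by (rule d)
  show "continuous_on UNIV (deriv f)"
    unfolding deq by (intro continuous_intros continuous_integral_cis Hi) auto
  have "\<bar>deriv f x\<bar> \<le> \<bar>Re (LINT \<xi>|lborel. ?H \<xi> * cis (x * \<xi>))\<bar>"
  proof -
    have "1 * \<bar>deriv f x\<bar> \<le> 2 * pi * \<bar>deriv f x\<bar>"
      using pi_gt3 by (intro mult_right_mono) auto
    then show ?thesis by (simp add: deq abs_divide)
  qed
  also have "\<dots> \<le> (LINT \<xi>|lborel. cmod (?H \<xi>))"
    by (rule abs_integral_cis_le[OF Hi])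
  also have "\<dots> = (LINT \<xi>|lborel. cmod (?G \<xi>))" by (simp add: norm_mult)
  also have "\<dots> \<le> bracket_const (r - 1) * sqrt (LINT \<xi>|lborel. (1 + \<xi>\<^sup>2) powr (r - 1) * (cmod (?G \<xi>))\<^sup>2)"
    by (rule w(2)) measurable
  also have "\<dots> \<le> bracket_const (r - 1) * sobolev_norm r f"
    unfolding F(3)
    by (intro mult_left_mono real_sqrt_le_mono integral_mono i F(2) le) (auto simp: bracket_const_def integral_nonneg)
  finally show "\<bar>deriv f x\<bar> \<le> bracket_const (r - 1) * sobolev_norm r f" .
qed

section \<open>The inverse Helmholtz operator\<close>

lemma laplace_kernel_integral:
  fixes x :: real
  shows "integrable lborel (\<lambda>y. exp (- \<bar>x - y\<bar>) / 2)"
    and "(LINT y|lborel. exp (- \<bar>x - y\<bar>) / 2) = (1::real)"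
proof -
  have i0: "integrable lborel (\<lambda>z. indicator {0<..} z *\<^sub>R exp (- z) :: real)"
    using integrable_I0i_exp_mscale[of 1] by (simp add: set_integrable_def)
  have v0: "(LINT z|lborel. indicator {0<..} z *\<^sub>R exp (- z)) = (1::real)"
    using LBINT_I0i_exp_mscale[of 1]
    by (simp add: interval_lebesgue_integral_0_infty set_lebesgue_integral_def)
  have i: "integrable lborel (\<lambda>y. indicator {0<..} (t + c * y) *\<^sub>R exp (- (t + c * y)))"
    if "c \<noteq> 0" for c t :: real
    using i0 by (subst lborel_integrable_real_affine_iff[OF that])
  have v: "(LINT y|lborel. indicator {0<..} (t + c * y) *\<^sub>R exp (- (t + c * y))) = (1::real)"
    if "\<bar>c\<bar> = 1" for c t :: real
  proof -
    have "c \<noteq> 0" using that by auto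
    from lborel_integral_real_affine[OF this, of "\<lambda>z. indicator {0<..} z *\<^sub>R exp (- z)" t] v0 that show ?thesis
      by simp
  qed
  \<comment> \<open>The two halves of the kernel are a translate and a reflection of the exponential
    density. Both vanish at \<open>y = x\<close>, so their sum matches the kernel only almost
    everywhere.\<close>
  let ?a = "\<lambda>y. indicator {0<..} (-x + 1 * y) *\<^sub>R exp (- (-x + 1 * y))"
  let ?b = "\<lambda>y. indicator {0<..} (x + (-1) * y) *\<^sub>R exp (- (x + (-1) * y))"
  have ae: "AE y in lborel. (?a y + ?b y) / 2 = exp (- \<bar>x - y\<bar>) / (2::real)"
    using AE_lborel_singleton[of x] by eventually_elim (auto simp: indicator_def)
  have ii: "integrable lborel (\<lambda>y. (?a y + ?b y) / 2 :: real)"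
    by (intro integrable_divide Bochner_Integration.integrable_add i) auto
  then show "integrable lborel (\<lambda>y. exp (- \<bar>x - y\<bar>) / (2::real))"
    by (subst (asm) integrable_cong_AE[OF _ _ ae]) auto
  have "(LINT y|lborel. exp (- \<bar>x - y\<bar>) / (2::real)) = (LINT y|lborel. (?a y + ?b y) / 2)"
    using ae by (intro integral_cong_AE) auto
  also have "\<dots> = 1"
    by (simp only: integral_divide_zero Bochner_Integration.integral_add[OF i i]) (simp add: v[of 1 "-x", simplified] v[of "-1" x, simplified])
  finally show "(LINT y|lborel. exp (- \<bar>x - y\<bar>) / (2::real)) = 1" .
qed

text \<open>Cut at \<open>x - 1\<close>: for upper limits near \<open>x\<close> the part below the
  cut is constant, and the fundamental theorem applies to the remaining compact interval.\<close>

lemma has_real_derivative_integral_atMost: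
  fixes g :: "real \<Rightarrow> real"
  assumes cont: "continuous_on UNIV g" and int: "\<And>x. set_integrable lborel {..x} g"
  shows "((\<lambda>x. LINT y:{..x}|lborel. g y) has_real_derivative g x) (at x)"
proof -
  let ?c = "x - 1" and ?d = "x + 1"
  have "((\<lambda>u. integral {?c..u} g) has_real_derivative g x) (at x within {?c..?d})"
    by (rule integral_has_real_derivative) (auto intro: continuous_on_subset[OF cont])
  then have "((\<lambda>u. (LINT y:{..<?c}|lborel. g y) + integral {?c..u} g) has_real_derivative 0 + g x) (at x)"
    by (intro DERIV_add DERIV_const) (simp add: at_within_Icc_at)
  moreover have "(LINT y:{..u}|lborel. g y) = (LINT y:{..<?c}|lborel. g y) + integral {?c..u} g" if "u \<in> {?c<..<?d}" for u
  proof -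
    have "{..u} = {..<?c} \<union> {?c..u}" using that by auto
    moreover have i1: "set_integrable lborel {..<?c} g"
      by (rule set_integrable_subset[OF int[of ?c]]) auto
    moreover have i2: "set_integrable lborel {?c..u} g"
      by (rule set_integrable_subset[OF int[of u]]) auto
    ultimately have "(LINT y:{..u}|lborel. g y) = (LINT y:{..<?c}|lborel. g y) + (LINT y:{?c..u}|lborel. g y)"
      by (simp only:) (intro set_integral_Un; auto)
    then show ?thesis by (simp only: set_borel_integral_eq_integral(2)[OF i2])
  qed
  ultimately show ?thesis
    by (auto intro: has_field_derivative_transform_within_open[where S = "{?c<..<?d}"])
qed

lemma integrable_laplace_mult:
  fixes f :: "real \<Rightarrow> real"
  assumes cont: "continuous_on UNIV f" and bound: "\<And>x. \<bar>f x\<bar> \<le> M"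
  shows "integrable lborel (\<lambda>y. exp (- \<bar>x - y\<bar>) / 2 * f y)"
proof (rule integrable_bound_everywhere)
  have [measurable]: "f \<in> borel_measurable borel"
    by (rule borel_measurable_continuous_onI[OF cont])
  show "integrable lborel (\<lambda>y. exp (- \<bar>x - y\<bar>) / 2 * M)"
    by (intro integrable_mult_left laplace_kernel_integral)
  show "norm (exp (- \<bar>x - y\<bar>) / 2 * f y) \<le> exp (- \<bar>x - y\<bar>) / 2 * M" for y
    using bound[of y] by (simp add: abs_mult)
  show "(\<lambda>y. exp (- \<bar>x - y\<bar>) / 2 * f y) \<in> borel_measurable lborel" by measurable
qed

text \<open>For \<open>y <= x\<close> the kernel factors as \<open>exp (- x) * exp y / 2\<close>, so
  the part of the convolution left of \<open>x\<close> is \<open>exp (- x) / 2\<close> times this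
  primitive. The part right of \<open>x\<close> has the same form after reflection.\<close>

definition exp_primitive :: "(real \<Rightarrow> real) \<Rightarrow> real \<Rightarrow> real" where
  "exp_primitive f x = (LINT y:{..x}|lborel. exp y * f y)"

lemma exp_primitive_eq: "exp (- x) * exp_primitive f x / 2 = (LINT y:{..x}|lborel. exp (- \<bar>x - y\<bar>) / 2 * f y)"
proof -
  have "(LINT y:{..x}|lborel. exp (- \<bar>x - y\<bar>) / 2 * f y) = (LINT y:{..x}|lborel. (exp (- x) / 2) * (exp y * f y))"
    by (rule set_lebesgue_integral_cong) (auto simp: mult_exp_exp)
  then show ?thesis by (simp add: exp_primitive_def)
qed

lemma exp_primitive_deriv:
  fixes f :: "real \<Rightarrow> real"
  assumes cont: "continuous_on UNIV f" and bound: "\<And>x. \<bar>f x\<bar> \<le> M"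
  shows "(exp_primitive f has_real_derivative exp x * f x) (at x)"
proof -
  have "set_integrable lborel {..x} (\<lambda>y. exp y * f y)" for x
  proof -
    have "integrable lborel (\<lambda>y. indicator {..x} y *\<^sub>R (2 * exp x * (exp (- \<bar>x - y\<bar>) / 2 * f y)))"
      by (intro integrable_mult_indicator integrable_mult_right integrable_laplace_mult[OF cont bound]) auto
    also have "(\<lambda>y. indicator {..x} y *\<^sub>R (2 * exp x * (exp (- \<bar>x - y\<bar>) / 2 * f y)))
       = (\<lambda>y. indicator {..x} y *\<^sub>R (exp y * f y))"
    proof
      fix y
      have "exp x * exp (- (x - y)) = exp y" by (simp add: mult_exp_exp)
      then show "indicator {..x} y *\<^sub>R (2 * exp x * (exp (- \<bar>x - y\<bar>) / 2 * f y)) = indicator {..x} y *\<^sub>R (exp y * f y)"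
        by (cases "y \<le> x") (auto simp: mult.assoc[symmetric])
    qed
    finally show ?thesis by (simp add: set_integrable_def)
  qed
  then show ?thesis
    unfolding exp_primitive_def[abs_def]
    by (intro has_real_derivative_integral_atMost continuous_intros cont)
qed

lemma laplace_integral_reflect:
  fixes f :: "real \<Rightarrow> real"
  assumes cont: "continuous_on UNIV f"
  shows "(LINT y:{x<..}|lborel. exp (- \<bar>x - y\<bar>) / 2 * f y) = (LINT y:{..-x}|lborel. exp (- \<bar>(- x) - y\<bar>) / 2 * f (- y))"
proof -
  have [measurable]: "f \<in> borel_measurable borel"
    by (rule borel_measurable_continuous_onI[OF cont])
  have "(LINT y:{x<..}|lborel. exp (- \<bar>x - y\<bar>) / 2 * f y) =
     \<bar>-1\<bar> *\<^sub>R (LINT y|lborel. indicator {x<..} (0 + (-1) * y) *\<^sub>R (exp (- \<bar>x - (0 + (-1) * y)\<bar>) / 2 * f (0 + (-1) * y)))"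
    unfolding set_lebesgue_integral_def
    by (rule lborel_integral_real_affine) auto
  also have "\<dots> = (LINT y|lborel. indicator {..-x} y *\<^sub>R (exp (- \<bar>(- x) - y\<bar>) / 2 * f (- y)))"
  proof -
    \<comment> \<open>Reflection sends \<open>{x<..}\<close> to the open half line
      \<open>{..<-x}\<close>; the endpoint is a null set.\<close>
    have "AE y in lborel. indicator {x<..} (0 + (-1) * y) *\<^sub>R (exp (- \<bar>x - (0 + (-1) * y)\<bar>) / 2 * f (0 + (-1) * y))
       = indicator {..-x} y *\<^sub>R (exp (- \<bar>(- x) - y\<bar>) / 2 * f (- y))"
      using AE_lborel_singleton[of "-x"]
    proof eventually_elim
      case (elim y)
      have "\<bar>x + y\<bar> = \<bar>- x - y\<bar>" by simp
      with elim show ?case by (simp add: indicator_def)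
    qed
    then show ?thesis by (simp only: abs_minus_cancel abs_one scaleR_one) (rule integral_cong_AE; measurable)
  qed
  finally show ?thesis by (simp add: set_lebesgue_integral_def)
qed

lemma inverse_helmholtz_split:
  fixes f :: "real \<Rightarrow> real"
  assumes cont: "continuous_on UNIV f" and bound: "\<And>x. \<bar>f x\<bar> \<le> M"
  shows "inverse_helmholtz f x = exp (- x) * exp_primitive f x / 2 + exp x * exp_primitive (\<lambda>y. f (- y)) (- x) / 2"
proof -
  have i: "set_integrable lborel A (\<lambda>y. exp (- \<bar>x - y\<bar>) / 2 * f y)" if "A \<in> sets borel" for A
    using that unfolding set_integrable_def
    by (intro integrable_mult_indicator integrable_laplace_mult[OF cont bound]) auto
  have "inverse_helmholtz f x = (LINT y:{..x} \<union> {x<..}|lborel. exp (- \<bar>x - y\<bar>) / 2 * f y)"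
  proof -
    have "{..x} \<union> {x<..} = UNIV" by auto
    then show ?thesis by (simp add: inverse_helmholtz_def set_lebesgue_integral_def)
  qed
  also have "\<dots> = (LINT y:{..x}|lborel. exp (- \<bar>x - y\<bar>) / 2 * f y) + (LINT y:{x<..}|lborel. exp (- \<bar>x - y\<bar>) / 2 * f y)"
    by (intro set_integral_Un i) auto
  also have "\<dots> = exp (- x) * exp_primitive f x / 2 + exp (- (- x)) * exp_primitive (\<lambda>y. f (- y)) (- x) / 2"
    by (simp only: exp_primitive_eq laplace_integral_reflect[OF cont])
  finally show ?thesis by simp
qed

lemma inverse_helmholtz_bound:
  fixes f :: "real \<Rightarrow> real"
  assumes cont: "continuous_on UNIV f" and bound: "\<And>x. \<bar>f x\<bar> \<le> M"
  shows "\<bar>inverse_helmholtz f x\<bar> \<le> M"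
proof -
  have "norm (inverse_helmholtz f x) \<le> (LINT y|lborel. exp (- \<bar>x - y\<bar>) / 2 * M)"
    unfolding inverse_helmholtz_def
  proof (rule Bochner_Integration.integral_norm_bound_integral)
    show "integrable lborel (\<lambda>y. exp (- \<bar>x - y\<bar>) / 2 * f y)"
      by (rule integrable_laplace_mult[OF cont bound])
    show "integrable lborel (\<lambda>y. exp (- \<bar>x - y\<bar>) / 2 * M)"
      by (intro integrable_mult_left laplace_kernel_integral)
    show "norm (exp (- \<bar>x - y\<bar>) / 2 * f y) \<le> exp (- \<bar>x - y\<bar>) / 2 * M" for y
      using bound[of y] by (simp add: abs_mult)
  qed
  also have "\<dots> = M"
    by (simp only: integral_mult_left_zero laplace_kernel_integral mult_1)
  finally show ?thesis by simp
qed

lemma abs_exp_primitive_le: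
  fixes f :: "real \<Rightarrow> real"
  assumes cont: "continuous_on UNIV f" and bound: "\<And>x. \<bar>f x\<bar> \<le> M"
  shows "\<bar>exp_primitive f x\<bar> \<le> exp_primitive (\<lambda>y. \<bar>f y\<bar>) x"
proof -
  have "\<bar>exp_primitive f x\<bar> \<le> (LINT y|lborel. norm (indicator {..x} y *\<^sub>R (exp y * f y)))"
    unfolding exp_primitive_def set_lebesgue_integral_def real_norm_def[symmetric] by (rule integral_norm_bound)
  also have "\<dots> = exp_primitive (\<lambda>y. \<bar>f y\<bar>) x"
    unfolding exp_primitive_def set_lebesgue_integral_def
    by (intro Bochner_Integration.integral_cong refl) (simp add: abs_mult)
  finally show ?thesis .
qed

text \<open>Write \<open>P = A + B\<close> for the contributions of \<open>y <= x\<close> and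
  \<open>y > x\<close>. Then \<open>A' = - A + f / 2\<close> and \<open>B' = B - f / 2\<close>, so
  the boundary terms cancel in \<open>P' = B - A\<close> and add up in \<open>P'' = P - f\<close>.
  Moreover \<open>|B - A|\<close> is at most the convolution of \<open>|f|\<close> with a kernel of
  mass 1.\<close>

lemma inverse_helmholtz_deriv:
  fixes f :: "real \<Rightarrow> real"
  assumes cont: "continuous_on UNIV f" and bound: "\<And>x. \<bar>f x\<bar> \<le> M"
  shows "(inverse_helmholtz f has_real_derivative deriv (inverse_helmholtz f) x) (at x)"
    and "(deriv (inverse_helmholtz f) has_real_derivative (inverse_helmholtz f x - f x)) (at x)"
    and "\<bar>deriv (inverse_helmholtz f) x\<bar> \<le> M"
proof -
  have cont': "continuous_on UNIV (\<lambda>y. f (- y))"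
    by (rule continuous_on_compose2[OF cont]) (auto intro: continuous_intros)
  note A = exp_primitive_deriv[OF cont bound] and B = exp_primitive_deriv[OF cont' bound]
  define P' where "P' x = exp x * exp_primitive (\<lambda>y. f (- y)) (- x) / 2 - exp (- x) * exp_primitive f x / 2" for x
  have B': "((\<lambda>x. exp_primitive (\<lambda>y. f (- y)) (- x)) has_real_derivative - (exp (- x) * f x)) (at x)" for x
    using DERIV_chain2[where f = "exp_primitive (\<lambda>y. f (- y))" and g = uminus and x = x and s = UNIV, OF B DERIV_minus[OF DERIV_ident]]
    by simp
  have eq: "inverse_helmholtz f = (\<lambda>x. exp (- x) * exp_primitive f x / 2 + exp x * exp_primitive (\<lambda>y. f (- y)) (- x) / 2)"
    by (intro ext inverse_helmholtz_split[OF cont bound])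
  have d1: "(inverse_helmholtz f has_real_derivative P' x) (at x)" for x
    unfolding eq
    by (rule derivative_eq_intros A B' refl | simp)+ (simp add: P'_def field_simps flip: exp_add)
  have dP: "deriv (inverse_helmholtz f) = P'"
    by (intro ext DERIV_imp_deriv d1)
  show "(inverse_helmholtz f has_real_derivative deriv (inverse_helmholtz f) x) (at x)"
    using d1 by (simp add: dP)
  have "(P' has_real_derivative (inverse_helmholtz f x - f x)) (at x)"
    unfolding P'_def[abs_def]
    by (rule derivative_eq_intros A B' refl | simp)+ (simp add: eq field_simps flip: exp_add)
  then show "(deriv (inverse_helmholtz f) has_real_derivative (inverse_helmholtz f x - f x)) (at x)"
    by (simp add: dP)
  have c: "continuous_on UNIV (\<lambda>y. \<bar>f y\<bar>)" and b: "\<And>x. \<bar>\<bar>f x\<bar>\<bar> \<le> M"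
    using cont bound by (auto intro: continuous_intros)
  have "\<bar>P' x\<bar> \<le> exp x * \<bar>exp_primitive (\<lambda>y. f (- y)) (- x)\<bar> / 2 + exp (- x) * \<bar>exp_primitive f x\<bar> / 2"
    unfolding P'_def by (rule order_trans[OF abs_triangle_ineq4]) (simp add: abs_mult)
  also have "\<dots> \<le> exp x * exp_primitive (\<lambda>y. \<bar>f (- y)\<bar>) (- x) / 2 + exp (- x) * exp_primitive (\<lambda>y. \<bar>f y\<bar>) x / 2"
    by (intro add_mono divide_right_mono mult_left_mono abs_exp_primitive_le[OF cont bound] abs_exp_primitive_le[OF cont' bound]) auto
  also have "\<dots> = inverse_helmholtz (\<lambda>y. \<bar>f y\<bar>) x"
    by (subst inverse_helmholtz_split[OF c b]) simp
  also have "\<dots> \<le> M"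
    using inverse_helmholtz_bound[OF c b, of x] by simp
  finally show "\<bar>deriv (inverse_helmholtz f) x\<bar> \<le> M"
    by (simp add: dP)
qed

text \<open>The derivative of \<open>P'\<close> is \<open>P - f\<close>, and each of the two terms
  is at most \<open>M\<close> in modulus.\<close>

lemma inverse_helmholtz_deriv_lipschitz:
  fixes f :: "real \<Rightarrow> real"
  assumes cont: "continuous_on UNIV f" and bound: "\<And>x. \<bar>f x\<bar> \<le> M"
  shows "\<bar>deriv (inverse_helmholtz f) x - deriv (inverse_helmholtz f) y\<bar> \<le> 2 * M * \<bar>x - y\<bar>"
proof -
  have "norm (deriv (inverse_helmholtz f) x - deriv (inverse_helmholtz f) y) \<le> 2 * M * norm (x - y)"
  proof (rule field_differentiable_bound[where S = UNIV and f' = "\<lambda>x. inverse_helmholtz f x - f x"])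
    show "norm (inverse_helmholtz f z - f z) \<le> 2 * M" for z
      using inverse_helmholtz_bound[OF cont bound, of z] bound[of z] by simp
  qed (auto intro!: inverse_helmholtz_deriv(2)[OF cont bound])
  then show ?thesis by simp
qed

text \<open>As the kernel is positive, \<open>f\<close> vanishes almost everywhere. The set where
  the continuous \<open>f\<close> is nonzero is then open and null, hence empty.\<close>

lemma inverse_helmholtz_eq_0D:
  fixes f :: "real \<Rightarrow> real"
  assumes cont: "continuous_on UNIV f" and bound: "\<And>x. \<bar>f x\<bar> \<le> M"
    and nonneg: "\<And>x. 0 \<le> f x" and zero: "inverse_helmholtz f x = 0"
  shows "f y = 0"
proof -
  have "AE y in lborel. exp (- \<bar>x - y\<bar>) / 2 * f y = 0"
    using zero nonneg unfolding inverse_helmholtz_def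
    by (subst (asm) integral_nonneg_eq_0_iff_AE[OF integrable_laplace_mult[OF cont bound]]) auto
  then have "AE y in lborel. \<not> f y \<noteq> 0"
    by eventually_elim simp
  moreover have [measurable]: "f \<in> borel_measurable borel"
    by (rule borel_measurable_continuous_onI[OF cont])
  have "{y \<in> space lborel. f y \<noteq> 0} \<in> sets lborel"
    by measurable
  ultimately have "{y. f y \<noteq> 0} \<in> null_sets lborel"
    by (subst (asm) AE_iff_null) auto
  then have "negligible {y. f y \<noteq> 0}"
    by (simp add: negligible_iff_null_sets null_sets_completionI)
  moreover have "open {y. f y \<noteq> 0}"
    using cont by (intro open_Collect_neq continuous_on_const)
  ultimately have "{y. f y \<noteq> 0} = {}"
    using open_not_negligible by blast
  then show ?thesis by auto
qed

section \<open>Uniqueness for zero data\<close>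

lemma abs_power_diff_le:
  fixes x y :: real
  assumes "\<bar>x\<bar> \<le> K" "\<bar>y\<bar> \<le> K"
  shows "\<bar>x ^ n - y ^ n\<bar> \<le> real n * K ^ (n - 1) * \<bar>x - y\<bar>"
proof -
  have "norm (x ^ n - y ^ n) \<le> (real n * K ^ (n - 1)) * norm (x - y)"
  proof (rule field_differentiable_bound[where S = "{-K..K}" and f' = "\<lambda>z. real n * z ^ (n - 1)"])
    fix z :: real assume z: "z \<in> {-K..K}"
    show "((\<lambda>z. z ^ n) has_field_derivative real n * z ^ (n - 1)) (at z within {-K..K})"
      by (auto intro!: derivative_eq_intros)
    have "\<bar>z\<bar> ^ (n - 1) \<le> K ^ (n - 1)"
      using z by (intro power_mono) auto
    then show "norm (real n * z ^ (n - 1)) \<le> real n * K ^ (n - 1)"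
      by (simp add: abs_mult power_abs mult_left_mono)
  qed (use assms in auto)
  then show ?thesis by simp
qed

text \<open>The source \<open>p\<close> is known only through a sup bound and a Lipschitz bound.
  Both are required for every \<open>N <= K\<close> that bounds \<open>u\<close> and
  \<open>ux\<close> at the given time, and both are linear in \<open>N\<close>: this lets an
  improved bound be fed back into the estimates. \<open>K\<close> itself is the a priori bound on
  all of \<open>{0..\<tau>}\<close>.\<close>

locale transport_equation =
  fixes n :: nat and \<tau> K C :: real and u ux p :: "real \<Rightarrow> real \<Rightarrow> real"
  assumes K: "0 \<le> K" and C: "0 \<le> C"
    and x_deriv: "\<And>t x. t \<in> {0..\<tau>} \<Longrightarrow> (u t has_real_derivative ux t x) (at x)"
    and t_deriv: "\<And>t x. t \<in> {0..\<tau>} \<Longrightarrow>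
          ((\<lambda>t. u t x) has_real_derivative - (u t x ^ n * ux t x) - p t x) (at t within {0..\<tau>})"
    and x_deriv_cont: "continuous_on ({0..\<tau>} \<times> UNIV) (\<lambda>(t, x). ux t x)"
    and u_bound: "\<And>t x. t \<in> {0..\<tau>} \<Longrightarrow> \<bar>u t x\<bar> \<le> K"
    and ux_bound: "\<And>t x. t \<in> {0..\<tau>} \<Longrightarrow> \<bar>ux t x\<bar> \<le> K"
    and p_bound: "\<And>t N x. t \<in> {0..\<tau>} \<Longrightarrow> N \<le> K \<Longrightarrow> (\<And>x. \<bar>u t x\<bar> \<le> N \<and> \<bar>ux t x\<bar> \<le> N) \<Longrightarrow> \<bar>p t x\<bar> \<le> C * N"
    and p_lipschitz: "\<And>t N x y. t \<in> {0..\<tau>} \<Longrightarrow> N \<le> K \<Longrightarrow> (\<And>x. \<bar>u t x\<bar> \<le> N \<and> \<bar>ux t x\<bar> \<le> N) \<Longrightarrow>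
          \<bar>p t x - p t y\<bar> \<le> C * N * \<bar>x - y\<bar>"
begin

text \<open>The chain rule along slanted lines needs joint differentiability. It follows from the
  two partial derivatives because the one in \<open>x\<close> is jointly continuous.\<close>

lemma total_derivative:
  assumes t: "t \<in> {0..\<tau>}"
  shows "((\<lambda>(t, x). u t x) has_derivative (\<lambda>(a, b). a * (- (u t x ^ n * ux t x) - p t x) + b * ux t x))
           (at (t, x) within {0..\<tau>} \<times> UNIV)"
proof -
  have c: "continuous (at (t, x) within {0..\<tau>} \<times> UNIV) (\<lambda>(t, x). ux t x)"
    using x_deriv_cont t by (simp add: continuous_on_eq_continuous_within)
  have "((\<lambda>(t, x). u t x) has_derivative
      (\<lambda>(a, b). a * (- (u t x ^ n * ux t x) - p t x) + blinfun_scaleR_left (ux t x) b))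
     (at (t, x) within {0..\<tau>} \<times> UNIV)"
  proof (rule has_derivative_partialsI)
    show "((\<lambda>t. u t x) has_derivative (\<lambda>a. a * (- (u t x ^ n * ux t x) - p t x))) (at t within {0..\<tau>})"
      using t_deriv[OF t, of x] by (simp add: has_field_derivative_def mult_commute_abs)
    show "(u t has_derivative blinfun_apply (blinfun_scaleR_left (ux t x))) (at x within UNIV)"
      if "t \<in> {0..\<tau>}" for t x
      using x_deriv[OF that, of x] by (simp add: has_field_derivative_def mult_commute_abs)
    show "continuous (at (t, x) within {0..\<tau>} \<times> UNIV) (\<lambda>(t, x). blinfun_scaleR_left (ux t x))"
      using bounded_linear.continuous[OF bounded_linear_blinfun_scaleR_left c] by (simp add: case_prod_beta')
  qed auto
  then show ?thesis by simp
qed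

text \<open>Instead of solving for the characteristics, we follow straight lines backwards from \<open>(t + h, x)\<close>
  with the speed frozen at its value \<open>c = u(t + h, x)\<^sup>n\<close> there. The true speed differs from \<open>c\<close> by
  \<open>O(h)\<close>, which costs \<open>O(h\<^sup>2)\<close> per step and disappears as \<open>h \<rightarrow> 0\<close>.\<close>

lemma path_derivative:
  assumes "0 \<le> t" "t + h \<le> \<tau>" "\<sigma> \<in> {0..h}"
  shows "((\<lambda>\<sigma>. u (t + \<sigma>) (x - (h - \<sigma>) * c)) has_real_derivative
     (c - u (t + \<sigma>) (x - (h - \<sigma>) * c) ^ n) * ux (t + \<sigma>) (x - (h - \<sigma>) * c) - p (t + \<sigma>) (x - (h - \<sigma>) * c))
     (at \<sigma> within {0..h})"
proof -
  let ?X = "x - (h - \<sigma>) * c" and ?s = "t + \<sigma>"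
  let ?f = "\<lambda>\<sigma>. (t + \<sigma>, x - (h - \<sigma>) * c)"
  have im: "?f ` {0..h} \<subseteq> {0..\<tau>} \<times> UNIV" using assms by auto
  have s: "?s \<in> {0..\<tau>}" using assms by auto
  have f: "(?f has_derivative (\<lambda>b. (b, b * c))) (at \<sigma> within {0..h})"
    by (auto intro!: derivative_eq_intros simp: algebra_simps)
  have "((\<lambda>\<sigma>. (\<lambda>(t, x). u t x) (?f \<sigma>)) has_derivative
     (\<lambda>b. (\<lambda>(a, b). a * (- (u ?s ?X ^ n * ux ?s ?X) - p ?s ?X) + b * ux ?s ?X) (b, b * c))) (at \<sigma> within {0..h})"
    by (rule has_derivative_in_compose[OF f has_derivative_subset[OF total_derivative[OF s] im]])
  moreover have "(\<lambda>b. (\<lambda>(a, b). a * (- (u ?s ?X ^ n * ux ?s ?X) - p ?s ?X) + b * ux ?s ?X) (b, b * c))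
     = (*) ((c - u ?s ?X ^ n) * ux ?s ?X - p ?s ?X)"
    by (auto simp: fun_eq_iff algebra_simps)
  ultimately show ?thesis
    by (simp add: has_field_derivative_def)
qed

definition "ut_bound = K ^ n * K + C * K"
definition "drift = real n * K ^ (n - 1) * (ut_bound + K * K ^ n)"
definition "speed_lipschitz = real n * K ^ (n - 1) * K"

lemma constants_nonneg: "0 \<le> ut_bound" "0 \<le> drift" "0 \<le> speed_lipschitz"
  using K C by (auto simp: ut_bound_def drift_def speed_lipschitz_def intro!: mult_nonneg_nonneg add_nonneg_nonneg)

section \<open>Estimates over a single time step\<close>

lemma abs_power_u_le: "t \<in> {0..\<tau>} \<Longrightarrow> \<bar>u t x ^ n\<bar> \<le> K ^ n"
  unfolding power_abs by (intro power_mono u_bound) auto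

lemma u_lipschitz:
  assumes t: "t \<in> {0..\<tau>}"
  shows "\<bar>u t x - u t y\<bar> \<le> K * \<bar>x - y\<bar>"
proof -
  have "norm (u t x - u t y) \<le> K * norm (x - y)"
    by (rule field_differentiable_bound[where S = UNIV and f' = "ux t"])
       (use x_deriv[OF t] ux_bound[OF t] in auto)
  then show ?thesis by simp
qed

lemma u_time_lipschitz:
  assumes t: "t \<in> {0..\<tau>}" "s \<in> {0..\<tau>}"
  shows "\<bar>u t x - u s x\<bar> \<le> ut_bound * \<bar>t - s\<bar>"
proof -
  have "norm (u t x - u s x) \<le> ut_bound * norm (t - s)"
  proof (rule field_differentiable_bound[where S = "{0..\<tau>}" and f' = "\<lambda>t. - (u t x ^ n * ux t x) - p t x"])
    fix r assume r: "r \<in> {0..\<tau>}"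
    show "((\<lambda>t. u t x) has_field_derivative - (u r x ^ n * ux r x) - p r x) (at r within {0..\<tau>})"
      by (rule t_deriv[OF r])
    have "\<bar>u r x ^ n * ux r x\<bar> \<le> K ^ n * K"
      unfolding abs_mult using abs_power_u_le[OF r] ux_bound[OF r] K by (intro mult_mono) auto
    moreover have "\<bar>p r x\<bar> \<le> C * K"
      using u_bound[OF r] ux_bound[OF r] by (intro p_bound[OF r]) auto
    ultimately show "norm (- (u r x ^ n * ux r x) - p r x) \<le> ut_bound"
      by (simp add: ut_bound_def)
  qed (use t in auto)
  then show ?thesis by simp
qed

lemma speed_drift:
  assumes "0 \<le> t" "t + h \<le> \<tau>" "\<sigma> \<in> {0..h}" and c: "c = u (t + h) x ^ n"
  shows "\<bar>c - u (t + \<sigma>) (x - (h - \<sigma>) * c) ^ n\<bar> \<le> drift * h"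
proof -
  let ?X = "x - (h - \<sigma>) * c"
  have th: "t + h \<in> {0..\<tau>}" and ts: "t + \<sigma> \<in> {0..\<tau>}" using assms by auto
  have c': "\<bar>c\<bar> \<le> K ^ n" unfolding c by (rule abs_power_u_le[OF th])
  have "\<bar>u (t + h) x - u (t + \<sigma>) ?X\<bar> \<le> \<bar>u (t + h) x - u (t + \<sigma>) x\<bar> + \<bar>u (t + \<sigma>) x - u (t + \<sigma>) ?X\<bar>"
    by simp
  also have "\<dots> \<le> ut_bound * \<bar>(t + h) - (t + \<sigma>)\<bar> + K * \<bar>x - ?X\<bar>"
    by (intro add_mono u_time_lipschitz u_lipschitz th ts)
  also have "\<dots> = ut_bound * (h - \<sigma>) + K * ((h - \<sigma>) * \<bar>c\<bar>)"
    using assms(3) by (simp add: abs_mult)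
  also have "\<dots> \<le> ut_bound * h + K * (h * K ^ n)"
    using assms(3) c' K constants_nonneg by (intro add_mono mult_left_mono mult_mono) auto
  finally have d: "\<bar>u (t + h) x - u (t + \<sigma>) ?X\<bar> \<le> (ut_bound + K * K ^ n) * h"
    by (simp add: algebra_simps)
  have "\<bar>u (t + h) x ^ n - u (t + \<sigma>) ?X ^ n\<bar> \<le> real n * K ^ (n - 1) * \<bar>u (t + h) x - u (t + \<sigma>) ?X\<bar>"
    by (intro abs_power_diff_le u_bound th ts)
  also have "\<dots> \<le> real n * K ^ (n - 1) * ((ut_bound + K * K ^ n) * h)"
    using d K by (intro mult_left_mono) auto
  finally show ?thesis by (simp add: c drift_def mult_ac)
qed

lemma speed_lipschitz:
  assumes t: "t \<in> {0..\<tau>}"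
  shows "\<bar>u t x ^ n - u t y ^ n\<bar> \<le> speed_lipschitz * \<bar>x - y\<bar>"
proof -
  have "\<bar>u t x ^ n - u t y ^ n\<bar> \<le> real n * K ^ (n - 1) * \<bar>u t x - u t y\<bar>"
    by (intro abs_power_diff_le u_bound t)
  also have "\<dots> \<le> real n * K ^ (n - 1) * (K * \<bar>x - y\<bar>)"
    using u_lipschitz[OF t] K by (intro mult_left_mono) auto
  finally show ?thesis by (simp add: speed_lipschitz_def mult_ac)
qed

text \<open>Along the line \<open>u\<close> changes at the rate \<open>(c - u ^ n) * ux - p\<close>.
  The first term is of order \<open>h\<close> by the drift bound, so it contributes only at order
  \<open>h^2\<close> and the crude \<open>K\<close> is good enough for \<open>ux\<close> there; the
  second is at most \<open>C * N\<close>.\<close>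

lemma value_step:
  assumes h: "0 \<le> t" "0 \<le> h" "t + h \<le> \<tau>"
    and N: "N \<le> K" "\<And>s x. s \<in> {t..t + h} \<Longrightarrow> \<bar>u s x\<bar> \<le> N \<and> \<bar>ux s x\<bar> \<le> N"
    and \<beta>: "\<And>x. \<bar>u t x\<bar> \<le> \<beta>"
  shows "\<bar>u (t + h) x\<bar> \<le> \<beta> + h * C * N + drift * K * h\<^sup>2"
proof -
  define c where "c = u (t + h) x ^ n"
  let ?X = "\<lambda>\<sigma>. x - (h - \<sigma>) * c"
  have "norm (u (t + h) (?X h) - u (t + 0) (?X 0)) \<le> (drift * h * K + C * N) * norm (h - 0)"
  proof (rule field_differentiable_bound[where S = "{0..h}" and f = "\<lambda>\<sigma>. u (t + \<sigma>) (?X \<sigma>)"])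
    fix \<sigma> assume \<sigma>: "\<sigma> \<in> {0..h}"
    then have s: "t + \<sigma> \<in> {0..\<tau>}" and s': "t + \<sigma> \<in> {t..t + h}" using h by auto
    show "((\<lambda>\<sigma>. u (t + \<sigma>) (?X \<sigma>)) has_field_derivative
       (c - u (t + \<sigma>) (?X \<sigma>) ^ n) * ux (t + \<sigma>) (?X \<sigma>) - p (t + \<sigma>) (?X \<sigma>)) (at \<sigma> within {0..h})"
      by (rule path_derivative[OF h(1,3) \<sigma>])
    have "\<bar>(c - u (t + \<sigma>) (?X \<sigma>) ^ n) * ux (t + \<sigma>) (?X \<sigma>)\<bar> \<le> drift * h * K"
      unfolding abs_mult using speed_drift[OF h(1,3) \<sigma> c_def] ux_bound[OF s] constants_nonneg h K
      by (intro mult_mono) auto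
    moreover have "\<bar>p (t + \<sigma>) (?X \<sigma>)\<bar> \<le> C * N"
      using N(2)[OF s'] by (intro p_bound[OF s N(1)]) auto
    ultimately show "norm ((c - u (t + \<sigma>) (?X \<sigma>) ^ n) * ux (t + \<sigma>) (?X \<sigma>) - p (t + \<sigma>) (?X \<sigma>)) \<le> drift * h * K + C * N"
      by simp
  qed (use h in auto)
  then have "\<bar>u (t + h) x - u t (?X 0)\<bar> \<le> h * C * N + drift * K * h\<^sup>2"
    using h by (simp add: algebra_simps power2_eq_square)
  then show ?thesis using \<beta>[of "?X 0"] by linarith
qed

text \<open>Two backward lines, one from each point, whose distance grows at most by the factor
  \<open>1 + speed_lipschitz * h\<close>. Without a second derivative the \<open>ux\<close> terms on
  the two lines cannot be compared and are bounded separately. This costs an error of order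
  \<open>h^2\<close> not proportional to \<open>|x - y|\<close>, which is why the bounds carry the
  additive \<open>\<beta>\<close>.\<close>

lemma difference_step:
  assumes h: "0 \<le> t" "0 \<le> h" "t + h \<le> \<tau>"
    and N: "0 \<le> N" "N \<le> K" "\<And>s x. s \<in> {t..t + h} \<Longrightarrow> \<bar>u s x\<bar> \<le> N \<and> \<bar>ux s x\<bar> \<le> N"
    and \<alpha>: "0 \<le> \<alpha>" "\<And>x y. \<bar>u t x - u t y\<bar> \<le> \<alpha> * \<bar>x - y\<bar> + \<beta>"
  shows "\<bar>u (t + h) x - u (t + h) y\<bar> \<le> (1 + speed_lipschitz * h) * (\<alpha> + h * C * N) * \<bar>x - y\<bar> + (\<beta> + 2 * drift * K * h\<^sup>2)"
proof -
  define c where "c = u (t + h) x ^ n"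
  define d where "d = u (t + h) y ^ n"
  define L where "L = (1 + speed_lipschitz * h) * \<bar>x - y\<bar>"
  let ?X = "\<lambda>\<sigma>. x - (h - \<sigma>) * c" and ?Y = "\<lambda>\<sigma>. y - (h - \<sigma>) * d"
  have L: "\<bar>?X \<sigma> - ?Y \<sigma>\<bar> \<le> L" if "\<sigma> \<in> {0..h}" for \<sigma>
  proof -
    have "\<bar>?X \<sigma> - ?Y \<sigma>\<bar> = \<bar>(x - y) - (h - \<sigma>) * (c - d)\<bar>" by (simp add: algebra_simps)
    also have "\<dots> \<le> \<bar>x - y\<bar> + (h - \<sigma>) * \<bar>c - d\<bar>"
      using that by (intro order_trans[OF abs_triangle_ineq4]) (simp add: abs_mult)
    also have "\<dots> \<le> \<bar>x - y\<bar> + h * (speed_lipschitz * \<bar>x - y\<bar>)"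
      unfolding c_def d_def using that h by (intro add_left_mono mult_mono speed_lipschitz) auto
    finally show ?thesis by (simp add: L_def algebra_simps)
  qed
  have "norm ((u (t + h) (?X h) - u (t + h) (?Y h)) - (u (t + 0) (?X 0) - u (t + 0) (?Y 0)))
     \<le> (2 * (drift * h * K) + C * N * L) * norm (h - 0)"
  proof (rule field_differentiable_bound[where S = "{0..h}" and f = "\<lambda>\<sigma>. u (t + \<sigma>) (?X \<sigma>) - u (t + \<sigma>) (?Y \<sigma>)"])
    fix \<sigma> assume \<sigma>: "\<sigma> \<in> {0..h}"
    then have s: "t + \<sigma> \<in> {0..\<tau>}" and s': "t + \<sigma> \<in> {t..t + h}" using h by auto
    let ?A = "(c - u (t + \<sigma>) (?X \<sigma>) ^ n) * ux (t + \<sigma>) (?X \<sigma>)"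
    let ?B = "(d - u (t + \<sigma>) (?Y \<sigma>) ^ n) * ux (t + \<sigma>) (?Y \<sigma>)"
    show "((\<lambda>\<sigma>. u (t + \<sigma>) (?X \<sigma>) - u (t + \<sigma>) (?Y \<sigma>)) has_field_derivative
       (?A - p (t + \<sigma>) (?X \<sigma>)) - (?B - p (t + \<sigma>) (?Y \<sigma>))) (at \<sigma> within {0..h})"
      by (intro DERIV_diff path_derivative[OF h(1,3) \<sigma>])
    have "\<bar>?A\<bar> \<le> drift * h * K"
      unfolding abs_mult using speed_drift[OF h(1,3) \<sigma> c_def] ux_bound[OF s] constants_nonneg h K
      by (intro mult_mono) auto
    moreover have "\<bar>?B\<bar> \<le> drift * h * K"
      unfolding abs_mult using speed_drift[OF h(1,3) \<sigma> d_def] ux_bound[OF s] constants_nonneg h K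
      by (intro mult_mono) auto
    moreover have "\<bar>p (t + \<sigma>) (?X \<sigma>) - p (t + \<sigma>) (?Y \<sigma>)\<bar> \<le> C * N * L"
    proof -
      have "\<bar>p (t + \<sigma>) (?X \<sigma>) - p (t + \<sigma>) (?Y \<sigma>)\<bar> \<le> C * N * \<bar>?X \<sigma> - ?Y \<sigma>\<bar>"
        using N(3)[OF s'] by (intro p_lipschitz[OF s N(2)]) auto
      also have "\<dots> \<le> C * N * L" using C N L[OF \<sigma>] by (intro mult_left_mono) auto
      finally show ?thesis .
    qed
    ultimately show "norm ((?A - p (t + \<sigma>) (?X \<sigma>)) - (?B - p (t + \<sigma>) (?Y \<sigma>))) \<le> 2 * (drift * h * K) + C * N * L"
      unfolding real_norm_def by linarith
  qed (use h in auto)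
  then have "\<bar>(u (t + h) x - u (t + h) y) - (u t (?X 0) - u t (?Y 0))\<bar> \<le> h * C * N * L + 2 * drift * K * h\<^sup>2"
    using h by (simp add: algebra_simps power2_eq_square)
  moreover have "\<bar>u t (?X 0) - u t (?Y 0)\<bar> \<le> \<alpha> * L + \<beta>"
    using \<alpha>(2)[of "?X 0" "?Y 0"] mult_left_mono[OF L[of 0] \<alpha>(1)] h by auto
  ultimately have "\<bar>u (t + h) x - u (t + h) y\<bar> \<le> (\<alpha> + h * C * N) * L + (\<beta> + 2 * drift * K * h\<^sup>2)"
    unfolding distrib_right by linarith
  then show ?thesis by (simp add: L_def mult_ac)
qed

text \<open>Dividing the interval into \<open>Suc m\<close> steps leaves a total error of
  \<open>drift * K * d^2 / Suc m\<close>, which disappears as \<open>m\<close> grows.\<close>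

lemma value_estimate:
  assumes ab: "0 \<le> a" "a + d \<le> \<tau>" "0 \<le> d"
    and N: "N \<le> K" "\<And>s x. s \<in> {a..a + d} \<Longrightarrow> \<bar>u s x\<bar> \<le> N \<and> \<bar>ux s x\<bar> \<le> N"
    and zero: "\<And>x. u a x = 0"
  shows "\<bar>u (a + d) x\<bar> \<le> d * C * N"
proof -
  have step: "\<forall>x. \<bar>u (a + real k * h) x\<bar> \<le> real k * (h * C * N + drift * K * h\<^sup>2)"
    if h: "0 \<le> h" and "real k * h \<le> d" for k h
    using that(2)
  proof (induction k)
    case 0 then show ?case using zero by simp
  next
    case (Suc k)
    let ?t = "a + real k * h"
    have th: "?t + h = a + real (Suc k) * h" by (simp add: algebra_simps)
    have le: "?t + h \<le> a + d" using Suc.prems unfolding th by simp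
    have t0: "a \<le> ?t" "0 \<le> h" "real k * h \<le> d" using h le by auto
    show ?case
    proof
      fix x
      have "\<bar>u (?t + h) x\<bar> \<le> real k * (h * C * N + drift * K * h\<^sup>2) + h * C * N + drift * K * h\<^sup>2"
      proof (rule value_step)
        show "\<bar>u s x\<bar> \<le> N \<and> \<bar>ux s x\<bar> \<le> N" if "s \<in> {?t..?t + h}" for s x
          by (rule N(2), unfold atLeastAtMost_iff, use that t0 le in \<open>unfold atLeastAtMost_iff, linarith\<close>)
        show "\<bar>u ?t x\<bar> \<le> real k * (h * C * N + drift * K * h\<^sup>2)" for x
          using Suc.IH t0 by simp
      qed (use t0 le ab N in auto)
      also have "\<dots> = real (Suc k) * (h * C * N + drift * K * h\<^sup>2)" by (simp add: algebra_simps)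
      finally show "\<bar>u (a + real (Suc k) * h) x\<bar> \<le> real (Suc k) * (h * C * N + drift * K * h\<^sup>2)"
        by (simp only: th)
    qed
  qed
  have "\<bar>u (a + d) x\<bar> \<le> d * C * N + drift * K * d\<^sup>2 * (1 / real (Suc m))" for m
  proof -
    let ?m = "real (Suc m)"
    have "?m * (d / ?m) = d" "?m * (d / ?m * C * N + drift * K * (d / ?m)\<^sup>2) = d * C * N + drift * K * d\<^sup>2 * (1 / ?m)"
      by (simp_all add: field_simps power2_eq_square del: of_nat_Suc)
    with step[of "d / ?m" "Suc m"] ab(3) show ?thesis by (simp del: of_nat_Suc)
  qed
  moreover have "(\<lambda>m. d * C * N + drift * K * d\<^sup>2 * (1 / real (Suc m))) \<longlonglongrightarrow> d * C * N + drift * K * d\<^sup>2 * 0"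
    by (intro tendsto_intros lim_1_over_n[THEN LIMSEQ_Suc])
  ultimately show ?thesis
    by (intro LIMSEQ_le_const) auto
qed

text \<open>Each step adds \<open>h * C * N\<close> to the Lipschitz constant, and every later step
  stretches it by \<open>1 + speed_lipschitz * h\<close>. The accumulated powers stay below
  \<open>exp (speed_lipschitz * d)\<close>, and the additive errors vanish under refinement.\<close>

lemma difference_estimate:
  assumes ab: "0 \<le> a" "a + d \<le> \<tau>" "0 \<le> d"
    and N: "0 \<le> N" "N \<le> K" "\<And>s x. s \<in> {a..a + d} \<Longrightarrow> \<bar>u s x\<bar> \<le> N \<and> \<bar>ux s x\<bar> \<le> N"
    and zero: "\<And>x. u a x = 0"
  shows "\<bar>u (a + d) x - u (a + d) y\<bar> \<le> exp (speed_lipschitz * d) * d * C * N * \<bar>x - y\<bar>"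
proof -
  \<comment> \<open>All \<open>k\<close> contributions receive the full power \<open>k\<close>,
    although the recent ones were stretched less; this keeps the bound in closed form.\<close>
  have step: "\<forall>x y. \<bar>u (a + real k * h) x - u (a + real k * h) y\<bar>
      \<le> (1 + speed_lipschitz * h) ^ k * (real k * (h * C * N)) * \<bar>x - y\<bar> + real k * (2 * drift * K * h\<^sup>2)"
    if h: "0 \<le> h" and "real k * h \<le> d" for k h
    using that(2)
  proof (induction k)
    case 0 then show ?case using zero by simp
  next
    case (Suc k)
    let ?t = "a + real k * h"
    let ?q = "1 + speed_lipschitz * h"
    have th: "?t + h = a + real (Suc k) * h" by (simp add: algebra_simps)
    have le: "?t + h \<le> a + d" using Suc.prems unfolding th by simp
    have t0: "a \<le> ?t" "0 \<le> h" "real k * h \<le> d" using h le by auto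
    have q: "1 \<le> ?q" using constants_nonneg t0 by simp
    have hCN: "0 \<le> h * C * N" using t0 C N by simp
    show ?case
    proof (intro allI)
      fix x y
      have "\<bar>u (?t + h) x - u (?t + h) y\<bar> \<le>
         ?q * (?q ^ k * (real k * (h * C * N)) + h * C * N) * \<bar>x - y\<bar> + (real k * (2 * drift * K * h\<^sup>2) + 2 * drift * K * h\<^sup>2)"
      proof (rule difference_step)
        show "\<bar>u s x\<bar> \<le> N \<and> \<bar>ux s x\<bar> \<le> N" if "s \<in> {?t..?t + h}" for s x
          by (rule N(3), unfold atLeastAtMost_iff, use that t0 le in \<open>unfold atLeastAtMost_iff, linarith\<close>)
        show "\<bar>u ?t x - u ?t y\<bar> \<le> ?q ^ k * (real k * (h * C * N)) * \<bar>x - y\<bar> + real k * (2 * drift * K * h\<^sup>2)" for x y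
          using Suc.IH t0 by simp
        show "0 \<le> ?q ^ k * (real k * (h * C * N))" using q t0 C N(1) by (intro mult_nonneg_nonneg zero_le_power) auto
      qed (use t0 le ab N in auto)
      also have "\<dots> \<le> ?q ^ Suc k * (real (Suc k) * (h * C * N)) * \<bar>x - y\<bar> + real (Suc k) * (2 * drift * K * h\<^sup>2)"
      proof (intro add_mono mult_right_mono)
        have "h * C * N \<le> ?q ^ k * (h * C * N)"
          using mult_right_mono[OF one_le_power[OF q, of k] hCN] by simp
        then have "?q ^ k * (real k * (h * C * N)) + h * C * N \<le> ?q ^ k * (real (Suc k) * (h * C * N))"
          by (simp add: algebra_simps)
        then have "?q * (?q ^ k * (real k * (h * C * N)) + h * C * N) \<le> ?q * (?q ^ k * (real (Suc k) * (h * C * N)))"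
          using q by (intro mult_left_mono) auto
        then show "?q * (?q ^ k * (real k * (h * C * N)) + h * C * N) \<le> ?q ^ Suc k * (real (Suc k) * (h * C * N))"
          by (simp only: power_Suc mult.assoc)
        show "real k * (2 * drift * K * h\<^sup>2) + 2 * drift * K * h\<^sup>2 \<le> real (Suc k) * (2 * drift * K * h\<^sup>2)"
          by (simp add: algebra_simps)
      qed auto
      finally show "\<bar>u (a + real (Suc k) * h) x - u (a + real (Suc k) * h) y\<bar> \<le>
         ?q ^ Suc k * (real (Suc k) * (h * C * N)) * \<bar>x - y\<bar> + real (Suc k) * (2 * drift * K * h\<^sup>2)"
        by (simp only: th)
    qed
  qed
  have "\<bar>u (a + d) x - u (a + d) y\<bar> \<le> exp (speed_lipschitz * d) * d * C * N * \<bar>x - y\<bar> + 2 * drift * K * d\<^sup>2 * (1 / real (Suc m))" for m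
  proof -
    let ?m = "real (Suc m)"
    have "(1 + speed_lipschitz * d / ?m) ^ Suc m \<le> exp (speed_lipschitz * d)"
    proof (rule exp_ge_one_plus_x_over_n_power_n)
      have "0 \<le> speed_lipschitz * d" using constants_nonneg(3) ab(3) by (rule mult_nonneg_nonneg)
      then show "- real (Suc m) \<le> speed_lipschitz * d" by simp
    qed simp
    then have "(1 + speed_lipschitz * d / ?m) ^ Suc m * (d * C * N * \<bar>x - y\<bar>) \<le> exp (speed_lipschitz * d) * (d * C * N * \<bar>x - y\<bar>)"
      using ab C N by (intro mult_right_mono) auto
    moreover have "\<bar>u (a + d) x - u (a + d) y\<bar> \<le> (1 + speed_lipschitz * d / ?m) ^ Suc m * (d * C * N * \<bar>x - y\<bar>) + 2 * drift * K * d\<^sup>2 * (1 / ?m)"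
    proof -
      have "?m * (d / ?m) = d" "?m * (d / ?m * C * N) = d * C * N" "?m * (2 * drift * K * (d / ?m)\<^sup>2) = 2 * drift * K * d\<^sup>2 * (1 / ?m)"
        by (simp_all add: field_simps power2_eq_square del: of_nat_Suc)
      with step[of "d / ?m" "Suc m"] ab(3) show ?thesis by (simp add: mult_ac del: of_nat_Suc power_Suc)
    qed
    ultimately show ?thesis by (simp add: mult_ac del: of_nat_Suc power_Suc)
  qed
  moreover have "(\<lambda>m. exp (speed_lipschitz * d) * d * C * N * \<bar>x - y\<bar> + 2 * drift * K * d\<^sup>2 * (1 / real (Suc m)))
     \<longlonglongrightarrow> exp (speed_lipschitz * d) * d * C * N * \<bar>x - y\<bar> + 2 * drift * K * d\<^sup>2 * 0"
    by (intro tendsto_intros lim_1_over_n[THEN LIMSEQ_Suc])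
  ultimately show ?thesis
    by (intro LIMSEQ_le_const) auto
qed

text \<open>A time span over which both estimates gain a factor of at least 2. \<open>C + 1\<close>
  avoids a zero denominator for \<open>C = 0\<close>; since \<open>block <= 1\<close>, the growth
  factor over the span is at most \<open>exp speed_lipschitz\<close>.\<close>

definition "block = 1 / (2 * (C + 1) * exp speed_lipschitz)"

lemma block: "0 < block" "block \<le> 1" "exp speed_lipschitz * block * C \<le> 1 / 2"
proof -
  have e: "1 \<le> exp speed_lipschitz" using constants_nonneg by simp
  have D: "1 \<le> 2 * (C + 1) * exp speed_lipschitz"
    using mult_mono[of 1 "2 * (C + 1)" 1 "exp speed_lipschitz"] e C by simp
  then show "0 < block" "block \<le> 1" by (auto simp: block_def)
  have "exp speed_lipschitz * block * C = C / (2 * (C + 1))"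
    using C by (simp add: block_def)
  also have "\<dots> \<le> 1 / 2"
    using C by (simp add: divide_simps)
  finally show "exp speed_lipschitz * block * C \<le> 1 / 2" .
qed

text \<open>From zero data a bound \<open>N\<close> on the interval improves to
  \<open>e * C * N\<close> for the values and to
  \<open>exp (speed_lipschitz * e) * e * C * N\<close> for the Lipschitz constant, where
  \<open>e <= block\<close>. The latter passes to \<open>ux\<close> as a limit of difference
  quotients.\<close>

lemma bound_halving:
  assumes ab: "0 \<le> a" "a + d \<le> \<tau>" "d \<le> block"
    and N: "0 \<le> N" "N \<le> K" "\<And>s x. s \<in> {a..a + d} \<Longrightarrow> \<bar>u s x\<bar> \<le> N \<and> \<bar>ux s x\<bar> \<le> N"
    and zero: "\<And>x. u a x = 0" and s: "s \<in> {a..a + d}"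
  shows "\<bar>u s x\<bar> \<le> N / 2 \<and> \<bar>ux s x\<bar> \<le> N / 2"
proof -
  define e where "e = s - a"
  have e: "0 \<le> e" "e \<le> d" "e \<le> block" "a + e = s" using s ab by (auto simp: e_def)
  have E1: "1 \<le> exp (speed_lipschitz * e)" using constants_nonneg e by simp
  have "speed_lipschitz * e \<le> speed_lipschitz * 1"
    using e block constants_nonneg by (intro mult_left_mono) auto
  then have "exp (speed_lipschitz * e) * e * C * N \<le> exp speed_lipschitz * block * C * N"
    using e(1-3) C N(1) block(1) by (intro mult_right_mono mult_mono) simp_all
  also have "\<dots> \<le> 1 / 2 * N" by (rule mult_right_mono[OF block(3) N(1)])
  finally have E: "exp (speed_lipschitz * e) * e * C * N \<le> N / 2" by simp
  have N': "\<bar>u r x\<bar> \<le> N \<and> \<bar>ux r x\<bar> \<le> N" if "r \<in> {a..a + e}" for r x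
    using that e(2) by (intro N(3)) simp
  have "\<bar>u s x\<bar> \<le> e * C * N"
    using value_estimate[OF ab(1) _ e(1) N(2) N' zero, of x] ab(2) e by simp
  also have "e * C * N = 1 * (e * C * N)" by simp
  also have "\<dots> \<le> exp (speed_lipschitz * e) * (e * C * N)"
    using E1 e C N by (intro mult_right_mono) auto
  also have "\<dots> \<le> N / 2" using E by (simp add: mult_ac)
  finally have "\<bar>u s x\<bar> \<le> N / 2" .
  moreover have "\<bar>ux s x\<bar> \<le> N / 2"
  proof -
    have s': "s \<in> {0..\<tau>}" using s ab by auto
    have lip: "\<bar>u s y - u s z\<bar> \<le> N / 2 * \<bar>y - z\<bar>" for y z
    proof -
      have "\<bar>u s y - u s z\<bar> \<le> exp (speed_lipschitz * e) * e * C * N * \<bar>y - z\<bar>"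
        using difference_estimate[OF ab(1) _ e(1) N(1,2) N' zero, of y z] ab(2) e by simp
      also have "\<dots> \<le> N / 2 * \<bar>y - z\<bar>" by (rule mult_right_mono[OF E]) simp
      finally show ?thesis .
    qed
    have "((\<lambda>h. (u s (x + h) - u s x) / h) \<longlongrightarrow> ux s x) (at 0)"
      using x_deriv[OF s', of x] by (simp add: DERIV_def)
    then have "((\<lambda>h. \<bar>(u s (x + h) - u s x) / h\<bar>) \<longlongrightarrow> \<bar>ux s x\<bar>) (at 0)"
      by (rule tendsto_rabs)
    moreover have "\<forall>\<^sub>F h in at 0. \<bar>(u s (x + h) - u s x) / h\<bar> \<le> N / 2"
      unfolding eventually_at_filter
    proof (intro always_eventually allI impI)
      fix h :: real assume "h \<noteq> 0"
      then show "\<bar>(u s (x + h) - u s x) / h\<bar> \<le> N / 2"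
        using lip[of "x + h" x] by (simp add: abs_divide divide_le_eq)
    qed
    ultimately show ?thesis by (intro tendsto_upperbound[of _ _ "at 0"]) auto
  qed
  ultimately show ?thesis by blast
qed

text \<open>Repeated halving on the same interval, starting from the a priori bound
  \<open>K\<close>.\<close>

lemma vanishes_on_block:
  assumes ab: "0 \<le> a" "a + d \<le> \<tau>" "d \<le> block"
    and zero: "\<And>x. u a x = 0" and s: "s \<in> {a..a + d}"
  shows "u s x = 0"
proof -
  have *: "\<forall>s\<in>{a..a + d}. \<forall>x. \<bar>u s x\<bar> \<le> K * (1 / 2) ^ j \<and> \<bar>ux s x\<bar> \<le> K * (1 / 2) ^ j" for j
  proof (induction j)
    case 0
    show ?case using u_bound ux_bound ab by auto
  next
    case (Suc j)
    have "K * (1 / 2) ^ j \<le> K"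
      using K by (intro mult_left_le) (auto simp: power_le_one)
    then have "\<bar>u s x\<bar> \<le> K * (1 / 2) ^ j / 2 \<and> \<bar>ux s x\<bar> \<le> K * (1 / 2) ^ j / 2" if "s \<in> {a..a + d}" for s x
      using that K Suc by (intro bound_halving[OF ab _ _ _ zero]) auto
    then show ?case by simp
  qed
  have "(\<lambda>j. K * (1 / 2) ^ j) \<longlonglongrightarrow> K * 0"
    by (intro tendsto_mult tendsto_const LIMSEQ_power_zero) simp
  then have "\<bar>u s x\<bar> \<le> K * 0"
    using * s by (intro LIMSEQ_le_const) auto
  then show ?thesis by simp
qed

text \<open>\<open>block\<close> depends on \<open>n\<close>, \<open>K\<close> and \<open>C\<close>
  but not on the starting time, so finitely many blocks reach \<open>t\<close>.\<close>

theorem vanishes: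
  assumes zero: "\<And>x. u 0 x = 0" and t: "t \<in> {0..\<tau>}"
  shows "u t x = 0"
proof -
  have *: "\<forall>s\<in>{0..\<tau>}. s \<le> real k * block \<longrightarrow> (\<forall>x. u s x = 0)" for k
  proof (induction k)
    case 0
    then show ?case using zero by auto
  next
    case (Suc k)
    show ?case
    proof (intro ballI impI allI)
      fix s x assume s: "s \<in> {0..\<tau>}" "s \<le> real (Suc k) * block"
      show "u s x = 0"
      proof (cases "s \<le> real k * block")
        case True
        then show ?thesis using Suc s by blast
      next
        case False
        let ?a = "real k * block"
        have a: "?a \<in> {0..\<tau>}" using False s block by (auto intro: order_trans[of _ s])
        have "\<And>x. u ?a x = 0" using a Suc by blast
        moreover have "s - ?a \<le> block" using s by (simp add: distrib_right)
        ultimately show ?thesis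
          using vanishes_on_block[of ?a "s - ?a" s x] False s(1) a by simp
      qed
    qed
  qed
  obtain k where "t \<le> real k * block"
    using reals_Archimedean3[OF block(1)] less_imp_le by blast
  then show ?thesis using * t by blast
qed

end

section \<open>Translation and reversal of time\<close>

context transport_equation
begin

text \<open>Turns vanishing at a later time \<open>a\<close> into zero initial data, with the same
  constants.\<close>

lemma shift:
  assumes "0 \<le> a" "a \<le> \<tau>"
  shows "transport_equation n (\<tau> - a) K C (\<lambda>t. u (a + t)) (\<lambda>t. ux (a + t)) (\<lambda>t. p (a + t))"
proof
  fix t x assume t: "t \<in> {0..\<tau> - a}"
  then have t': "a + t \<in> {0..\<tau>}" using assms by auto
  show "(u (a + t) has_real_derivative ux (a + t) x) (at x)" by (rule x_deriv[OF t'])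
  have "((\<lambda>s. u (a + s) x) has_real_derivative (- (u (a + t) x ^ n * ux (a + t) x) - p (a + t) x) * 1) (at t within {0..\<tau> - a})"
  proof (rule DERIV_image_chain[where g = "\<lambda>s. a + s" and f = "\<lambda>t. u t x", unfolded comp_def])
    show "((\<lambda>t. u t x) has_real_derivative - (u (a + t) x ^ n * ux (a + t) x) - p (a + t) x) (at (a + t) within (\<lambda>s. a + s) ` {0..\<tau> - a})"
      by (rule DERIV_subset[OF t_deriv[OF t']]) (use assms in auto)
  qed (auto intro!: derivative_eq_intros)
  then show "((\<lambda>s. u (a + s) x) has_real_derivative - (u (a + t) x ^ n * ux (a + t) x) - p (a + t) x) (at t within {0..\<tau> - a})"
    by simp
  show "\<bar>u (a + t) x\<bar> \<le> K" "\<bar>ux (a + t) x\<bar> \<le> K" by (rule u_bound[OF t'] ux_bound[OF t'])+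
next
  fix t N x y assume t: "t \<in> {0..\<tau> - a}" and N: "N \<le> K" "\<And>x. \<bar>u (a + t) x\<bar> \<le> N \<and> \<bar>ux (a + t) x\<bar> \<le> N"
  then have t': "a + t \<in> {0..\<tau>}" using assms by auto
  show "\<bar>p (a + t) x\<bar> \<le> C * N" by (rule p_bound[OF t' N])
  show "\<bar>p (a + t) x - p (a + t) y\<bar> \<le> C * N * \<bar>x - y\<bar>" by (rule p_lipschitz[OF t' N])
next
  have "continuous_on ({0..\<tau> - a} \<times> UNIV) (\<lambda>z. (\<lambda>(t, x). ux t x) (a + fst z, snd z))"
    by (rule continuous_on_compose2[OF x_deriv_cont]) (use assms in \<open>auto intro!: continuous_intros\<close>)
  then show "continuous_on ({0..\<tau> - a} \<times> UNIV) (\<lambda>(t, x). ux (a + t) x)"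
    by (simp add: case_prod_beta')
qed (rule K C)+

text \<open>For odd \<open>n\<close> the equation is invariant under \<open>u(t, x) \<mapsto> - u(\<tau> - t, x)\<close>.\<close>

lemma time_reversal:
  assumes "odd n"
  shows "transport_equation n \<tau> K C (\<lambda>t x. - u (\<tau> - t) x) (\<lambda>t x. - ux (\<tau> - t) x) (\<lambda>t. p (\<tau> - t))"
proof
  fix t x assume t: "t \<in> {0..\<tau>}"
  then have t': "\<tau> - t \<in> {0..\<tau>}" by auto
  show "((\<lambda>x. - u (\<tau> - t) x) has_real_derivative - ux (\<tau> - t) x) (at x)"
    by (rule DERIV_minus[OF x_deriv[OF t']])
  have "((\<lambda>s. u (\<tau> - s) x) has_real_derivative (- (u (\<tau> - t) x ^ n * ux (\<tau> - t) x) - p (\<tau> - t) x) * (- 1)) (at t within {0..\<tau>})"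
  proof (rule DERIV_image_chain[where g = "\<lambda>s. \<tau> - s" and f = "\<lambda>t. u t x", unfolded comp_def])
    show "((\<lambda>t. u t x) has_real_derivative - (u (\<tau> - t) x ^ n * ux (\<tau> - t) x) - p (\<tau> - t) x) (at (\<tau> - t) within (\<lambda>s. \<tau> - s) ` {0..\<tau>})"
      by (rule DERIV_subset[OF t_deriv[OF t']]) auto
  qed (auto intro!: derivative_eq_intros)
  \<comment> \<open>For odd \<open>n\<close> the two signs in \<open>(- u) ^ n * - ux\<close>
    cancel, so the transport term and \<open>p\<close> keep their signs; the outer minus cancels
    against the inner derivative \<open>- 1\<close>.\<close>
  moreover have "- ((- (u (\<tau> - t) x ^ n * ux (\<tau> - t) x) - p (\<tau> - t) x) * (- 1))
      = - ((- u (\<tau> - t) x) ^ n * - ux (\<tau> - t) x) - p (\<tau> - t) x"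
    using assms by simp
  ultimately show "((\<lambda>s. - u (\<tau> - s) x) has_real_derivative - ((- u (\<tau> - t) x) ^ n * - ux (\<tau> - t) x) - p (\<tau> - t) x) (at t within {0..\<tau>})"
    using DERIV_minus by metis
  show "\<bar>- u (\<tau> - t) x\<bar> \<le> K" "\<bar>- ux (\<tau> - t) x\<bar> \<le> K" using u_bound[OF t'] ux_bound[OF t'] by auto
next
  fix t N x y assume t: "t \<in> {0..\<tau>}" and N: "N \<le> K" "\<And>x. \<bar>- u (\<tau> - t) x\<bar> \<le> N \<and> \<bar>- ux (\<tau> - t) x\<bar> \<le> N"
  then have t': "\<tau> - t \<in> {0..\<tau>}" and N': "\<And>x. \<bar>u (\<tau> - t) x\<bar> \<le> N \<and> \<bar>ux (\<tau> - t) x\<bar> \<le> N" by auto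
  show "\<bar>p (\<tau> - t) x\<bar> \<le> C * N" by (rule p_bound[OF t' N(1) N'])
  show "\<bar>p (\<tau> - t) x - p (\<tau> - t) y\<bar> \<le> C * N * \<bar>x - y\<bar>" by (rule p_lipschitz[OF t' N(1) N'])
next
  have "continuous_on ({0..\<tau>} \<times> UNIV) (\<lambda>z. - (\<lambda>(t, x). ux t x) (\<tau> - fst z, snd z))"
    by (intro continuous_on_minus continuous_on_compose2[OF x_deriv_cont]) (auto intro!: continuous_intros)
  then show "continuous_on ({0..\<tau>} \<times> UNIV) (\<lambda>(t, x). - ux (\<tau> - t) x)"
    by (simp add: case_prod_beta')
qed (rule K C)+

end

section \<open>Solutions\<close>

lemma sobolev_diff:
  assumes "f \<in> sobolev r" "g \<in> sobolev r"
  shows "(\<lambda>x. f x - g x) \<in> sobolev r"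
  using sobolev_lincomb[OF assms, of 1 "-1"] by simp

lemma uniformly_close:
  fixes w :: "real \<Rightarrow> 'a \<Rightarrow> real"
  assumes lim: "(e \<longlongrightarrow> 0) (at t0 within S)" and le: "\<And>t x. t \<in> S \<Longrightarrow> \<bar>w t x - w t0 x\<bar> \<le> B * e t"
    and eps: "\<epsilon> > 0"
  shows "\<exists>d>0. \<forall>t\<in>S. \<bar>t - t0\<bar> < d \<longrightarrow> (\<forall>x. \<bar>w t x - w t0 x\<bar> < \<epsilon>)"
proof -
  have "((\<lambda>t. B * e t) \<longlongrightarrow> B * 0) (at t0 within S)"
    by (intro tendsto_mult tendsto_const lim)
  then have "\<forall>\<^sub>F t in at t0 within S. B * e t < \<epsilon>"
    using eps by (intro order_tendstoD(2)) auto
  then obtain d where d: "d > 0" "\<And>t. t \<in> S \<Longrightarrow> t \<noteq> t0 \<Longrightarrow> dist t t0 < d \<Longrightarrow> B * e t < \<epsilon>"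
    by (auto simp: eventually_at)
  have "\<bar>w t x - w t0 x\<bar> < \<epsilon>" if "t \<in> S" "\<bar>t - t0\<bar> < d" for t x
  proof (cases "t = t0")
    \<comment> \<open>The limit of \<open>e\<close> at \<open>t0\<close> says nothing about
      \<open>t0\<close> itself.\<close>
    case True
    then show ?thesis using eps by simp
  next
    case False
    then show ?thesis using le[OF that(1), of x] d(2)[OF that(1) False] that(2) by (simp add: dist_real_def)
  qed
  with d(1) show ?thesis by blast
qed

text \<open>The embedding bounds, applied to the difference \<open>u t - u t0\<close>, turn
  continuity in the Sobolev norm into continuity in time that is uniform in
  \<open>x\<close>.\<close>

lemma sobolev_C0_uniform:
  assumes C0: "sobolev_C0 T r u" and t0: "t0 \<in> {0..<T}" and eps: "\<epsilon> > 0"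
  shows "r > 1 / 2 \<Longrightarrow> \<exists>d>0. \<forall>t\<in>{0..<T}. \<bar>t - t0\<bar> < d \<longrightarrow> (\<forall>x. \<bar>u t x - u t0 x\<bar> < \<epsilon>)"
    and "r > 3 / 2 \<Longrightarrow> \<exists>d>0. \<forall>t\<in>{0..<T}. \<bar>t - t0\<bar> < d \<longrightarrow> (\<forall>x. \<bar>deriv (u t) x - deriv (u t0) x\<bar> < \<epsilon>)"
proof -
  let ?e = "\<lambda>t. sobolev_norm r (\<lambda>x. u t x - u t0 x)"
  have u: "u t \<in> sobolev r" "continuous_on UNIV (u t)" if "t \<in> {0..<T}" for t
    using C0 that by (auto simp: sobolev_C0_def)
  have lim: "(?e \<longlongrightarrow> 0) (at t0 within {0..<T})"
    using C0 t0 by (auto simp: sobolev_C0_def)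
  have d: "(\<lambda>x. u t x - u t0 x) \<in> sobolev r" "continuous_on UNIV (\<lambda>x. u t x - u t0 x)" if "t \<in> {0..<T}" for t
    using u[OF that] u[OF t0] by (auto intro: sobolev_diff continuous_intros)
  show "\<exists>d>0. \<forall>t\<in>{0..<T}. \<bar>t - t0\<bar> < d \<longrightarrow> (\<forall>x. \<bar>u t x - u t0 x\<bar> < \<epsilon>)" if "r > 1 / 2"
    by (rule uniformly_close[OF lim sobolev_sup_bound[OF that d] eps])
  show "\<exists>d>0. \<forall>t\<in>{0..<T}. \<bar>t - t0\<bar> < d \<longrightarrow> (\<forall>x. \<bar>deriv (u t) x - deriv (u t0) x\<bar> < \<epsilon>)" if r: "r > 3 / 2"
  proof (rule uniformly_close[OF lim _ eps])
    fix t x assume t: "t \<in> {0..<T}"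
    have "deriv (\<lambda>x. u t x - u t0 x) x = deriv (u t) x - deriv (u t0) x"
      by (intro DERIV_imp_deriv DERIV_diff sobolev_C1(1)[OF r] u t t0)
    then show "\<bar>deriv (u t) x - deriv (u t0) x\<bar> \<le> bracket_const (r - 1) * ?e t"
      using sobolev_C1(3)[OF r d[OF t], of x] by simp
  qed
qed

text \<open>The error of the difference quotient is itself a continuous member of
  \<open>sobolev r\<close>, so its values are controlled by the norm that tends to 0.\<close>

lemma sobolev_time_deriv_pointwise:
  assumes r: "r > 1 / 2" and u: "\<And>t. t \<in> {0..<T} \<Longrightarrow> u t \<in> sobolev r \<and> continuous_on UNIV (u t)"
    and v: "\<And>t. t \<in> {0..<T} \<Longrightarrow> v t \<in> sobolev r \<and> continuous_on UNIV (v t)"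
    and uv: "sobolev_time_deriv T r u v" and t0: "t0 \<in> {0..<T}"
  shows "((\<lambda>t. u t x) has_real_derivative v t0 x) (at t0 within {0..<T})"
proof -
  let ?q = "\<lambda>t x. (u t x - u t0 x) / (t - t0) - v t0 x"
  let ?e = "\<lambda>t. sobolev_norm r (?q t)"
  have le: "\<bar>?q t x\<bar> \<le> bracket_const r * ?e t" if "t \<in> {0..<T}" "t \<noteq> t0" for t
  proof (rule sobolev_sup_bound[OF r])
    have "(\<lambda>x. 1 / (t - t0) * (u t x - u t0 x) + (- 1) * v t0 x) \<in> sobolev r"
      using u v that(1) t0 by (intro sobolev_lincomb sobolev_diff) auto
    then show "?q t \<in> sobolev r" by simp
    show "continuous_on UNIV (?q t)" using u[OF that(1)] u[OF t0] v[OF t0] that(2) by (auto intro!: continuous_intros)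
  qed
  have "((\<lambda>t. bracket_const r * ?e t) \<longlongrightarrow> bracket_const r * 0) (at t0 within {0..<T})"
    using uv t0 by (intro tendsto_mult tendsto_const) (auto simp: sobolev_time_deriv_def)
  then have lim: "((\<lambda>t. bracket_const r * ?e t) \<longlongrightarrow> 0) (at t0 within {0..<T})" by simp
  have "((\<lambda>t. ?q t x) \<longlongrightarrow> 0) (at t0 within {0..<T})"
  proof (rule Lim_null_comparison[OF _ lim])
    show "\<forall>\<^sub>F t in at t0 within {0..<T}. norm (?q t x) \<le> bracket_const r * ?e t"
      using le by (auto simp: eventually_at_filter)
  qed
  then show ?thesis
    by (simp add: has_field_derivative_iff LIM_zero_iff)
qed

text \<open>A finite subcover; the sum of the absolute values of its local bounds exceeds each of
  them and is nonnegative even for an empty cover.\<close>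

lemma compact_locally_bounded:
  fixes P :: "'a::metric_space \<Rightarrow> real \<Rightarrow> bool"
  assumes S: "compact S" and loc: "\<And>a. a \<in> S \<Longrightarrow> \<exists>d>0. \<exists>M. \<forall>t\<in>S. dist t a < d \<longrightarrow> P t M"
    and mono: "\<And>t M M'. P t M \<Longrightarrow> M \<le> M' \<Longrightarrow> P t M'"
  shows "\<exists>M\<ge>0. \<forall>t\<in>S. P t M"
proof -
  obtain d M where d: "\<And>a. a \<in> S \<Longrightarrow> d a > 0" and M: "\<And>a t. a \<in> S \<Longrightarrow> t \<in> S \<Longrightarrow> dist t a < d a \<Longrightarrow> P t (M a)"
    using loc by metis
  obtain A where A: "A \<subseteq> S" "finite A" "S \<subseteq> (\<Union>a\<in>A. ball a (d a))"
    by (rule compactE_image[OF S, of S "\<lambda>a. ball a (d a)"]) (use d in auto)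
  define B where "B = (\<Sum>a\<in>A. \<bar>M a\<bar>)"
  have "P t B" if t: "t \<in> S" for t
  proof -
    obtain a where a: "a \<in> A" "dist t a < d a"
      using subsetD[OF A(3) t] by (auto simp: dist_commute)
    have "M a \<le> \<bar>M a\<bar>" by simp
    also have "\<dots> \<le> B" unfolding B_def using A(2) a(1) by (intro member_le_sum) auto
    finally show ?thesis using M[of a t] a A(1) t mono by blast
  qed
  moreover have "0 \<le> B" by (simp add: B_def sum_nonneg)
  ultimately show ?thesis by blast
qed

definition "density_const n = real n / 2 + real n * (real n + 3) / (2 * (real n + 1))"

text \<open>The density is homogeneous of degree \<open>n + 1\<close> in \<open>w\<close> and its
  derivative, hence at most \<open>density_const n * N ^ (n + 1)\<close>. Replacing \<open>n\<close>
  of the factors by \<open>K\<close> leaves a bound linear in \<open>N\<close>, as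
  \<open>transport_equation\<close> demands of the source.\<close>

lemma nonlocal_density_bound:
  assumes n: "n > 0" and N: "N \<le> K" "\<bar>w x\<bar> \<le> N" "\<bar>deriv w x\<bar> \<le> N"
  shows "\<bar>nonlocal_density n w x\<bar> \<le> density_const n * K ^ n * N"
proof -
  have N0: "0 \<le> N" using N(2) by simp
  have "\<bar>w x ^ (n - 1) * (deriv w x)\<^sup>2\<bar> \<le> N ^ (n - 1) * N\<^sup>2"
    unfolding abs_mult power_abs using N N0 by (intro mult_mono power_mono) auto
  also have "\<dots> = N ^ Suc n" using n by (simp flip: power_add)
  finally have 1: "\<bar>w x ^ (n - 1) * (deriv w x)\<^sup>2\<bar> \<le> N ^ Suc n" .
  have 2: "\<bar>w x ^ (n + 1)\<bar> \<le> N ^ Suc n"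
    unfolding power_abs using N by (simp add: power_mono del: power_Suc)
  have "\<bar>nonlocal_density n w x\<bar> \<le> real n / 2 * \<bar>w x ^ (n - 1) * (deriv w x)\<^sup>2\<bar>
     + real n * (real n + 3) / (2 * (real n + 1)) * \<bar>w x ^ (n + 1)\<bar>"
    unfolding nonlocal_density_def by (rule order_trans[OF abs_triangle_ineq]) (simp add: abs_mult mult_ac)
  also have "\<dots> \<le> real n / 2 * N ^ Suc n + real n * (real n + 3) / (2 * (real n + 1)) * N ^ Suc n"
    using 1 2 by (intro add_mono mult_left_mono) auto
  also have "\<dots> = density_const n * (N ^ n * N)"
    by (simp add: density_const_def algebra_simps)
  also have "\<dots> \<le> density_const n * (K ^ n * N)"
    using N N0 by (intro mult_left_mono mult_right_mono power_mono) (auto simp: density_const_def)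
  finally show ?thesis by (simp add: mult_ac)
qed

lemma nonlocal_density_continuous:
  assumes "continuous_on UNIV w" "continuous_on UNIV (deriv w)"
  shows "continuous_on UNIV (nonlocal_density n w)"
  unfolding nonlocal_density_def[abs_def] by (intro continuous_intros assms)

text \<open>Both exponents \<open>n - 1\<close> and \<open>n + 1\<close> are even, so both terms are
  nonnegative and a zero sum kills each; the second has a positive coefficient.\<close>

lemma nonlocal_density_nonneg:
  assumes "odd n"
  shows "0 \<le> nonlocal_density n w x" "nonlocal_density n w x = 0 \<Longrightarrow> w x = 0"
proof -
  have n: "n > 0" using assms odd_pos by blast
  have 1: "0 \<le> real n / 2 * w x ^ (n - 1) * (deriv w x)\<^sup>2"
    using assms by (intro mult_nonneg_nonneg zero_le_even_power) auto
  have 2: "0 \<le> w x ^ (n + 1)" using assms by (intro zero_le_even_power) auto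
  then have 3: "0 \<le> real n * (real n + 3) / (2 * (real n + 1)) * w x ^ (n + 1)" by simp
  show "0 \<le> nonlocal_density n w x"
    unfolding nonlocal_density_def using 1 3 by linarith
  assume "nonlocal_density n w x = 0"
  then have "real n * (real n + 3) / (2 * (real n + 1)) * w x ^ (n + 1) = 0"
    unfolding nonlocal_density_def using 1 3 by linarith
  then show "w x = 0" using n by (auto simp: add_eq_0_iff)
qed

text \<open>Norm continuity bounds \<open>u\<close> and its slope near each time, uniformly in
  \<open>x\<close>; compactness of \<open>{0..\<tau>}\<close> makes the bound uniform in time.
  Nothing is claimed up to \<open>T\<close>.\<close>

lemma solution_bounded:
  assumes s: "s > 3 / 2" and C0: "sobolev_C0 T s u" and \<tau>: "\<tau> < T"
  shows "\<exists>K\<ge>0. \<forall>t\<in>{0..\<tau>}. \<forall>x. \<bar>u t x\<bar> \<le> K \<and> \<bar>deriv (u t) x\<bar> \<le> K"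
proof (rule compact_locally_bounded)
  fix a assume a: "a \<in> {0..\<tau>}"
  then have a': "a \<in> {0..<T}" using \<tau> by auto
  have u: "u a \<in> sobolev s" "continuous_on UNIV (u a)" using C0 a' by (auto simp: sobolev_C0_def)
  have s': "s > 1 / 2" using s by simp
  define M where "M = bracket_const s * sobolev_norm s (u a)"
  define M' where "M' = bracket_const (s - 1) * sobolev_norm s (u a)"
  have M: "\<bar>u a x\<bar> \<le> M" "\<bar>deriv (u a) x\<bar> \<le> M'" for x
    unfolding M_def M'_def by (rule sobolev_sup_bound[OF s' u] sobolev_C1(3)[OF s u])+
  obtain d where d: "d > 0" "\<And>t x. t \<in> {0..<T} \<Longrightarrow> \<bar>t - a\<bar> < d \<Longrightarrow> \<bar>u t x - u a x\<bar> < 1"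
    using sobolev_C0_uniform(1)[OF C0 a' zero_less_one s'] by blast
  obtain d' where d': "d' > 0" "\<And>t x. t \<in> {0..<T} \<Longrightarrow> \<bar>t - a\<bar> < d' \<Longrightarrow> \<bar>deriv (u t) x - deriv (u a) x\<bar> < 1"
    using sobolev_C0_uniform(2)[OF C0 a' zero_less_one s] by blast
  have "\<bar>u t x\<bar> \<le> max M M' + 1 \<and> \<bar>deriv (u t) x\<bar> \<le> max M M' + 1" if t: "t \<in> {0..\<tau>}" "dist t a < min d d'" for t x
  proof -
    have t': "t \<in> {0..<T}" "\<bar>t - a\<bar> < d" "\<bar>t - a\<bar> < d'" using t \<tau> by (auto simp: dist_real_def)
    show ?thesis using d(2)[OF t'(1,2), of x] d'(2)[OF t'(1,3), of x] M[of x] by linarith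
  qed
  then show "\<exists>d>0. \<exists>M. \<forall>t\<in>{0..\<tau>}. dist t a < d \<longrightarrow> (\<forall>x. \<bar>u t x\<bar> \<le> M \<and> \<bar>deriv (u t) x\<bar> \<le> M)"
    using d(1) d'(1) by (intro exI[of _ "min d d'"] conjI exI[of _ "max M M' + 1"]) auto
next
  fix t M M' assume "\<forall>x. \<bar>u t x\<bar> \<le> M \<and> \<bar>deriv (u t) x\<bar> \<le> M" "M \<le> M'"
  then show "\<forall>x. \<bar>u t x\<bar> \<le> M' \<and> \<bar>deriv (u t) x\<bar> \<le> M'" by (meson order_trans)
qed simp

lemma solution_time_deriv:
  assumes s: "s > 3 / 2" and sol: "solution n T s u" and t: "t \<in> {0..<T}"
  shows "((\<lambda>t. u t x) has_real_derivative
     - (u t x ^ n * deriv (u t) x) - deriv (inverse_helmholtz (nonlocal_density n (u t))) x) (at t within {0..<T})"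
proof -
  obtain v where C0: "sobolev_C0 T s u" and v: "sobolev_C0 T (s - 1) v" "sobolev_time_deriv T (s - 1) u v"
    and eq: "\<And>t x. t \<in> {0..<T} \<Longrightarrow> v t x + u t x ^ n * deriv (u t) x + deriv (inverse_helmholtz (nonlocal_density n (u t))) x = 0"
    using sol by (auto simp: solution_def)
  have "((\<lambda>t. u t x) has_real_derivative v t x) (at t within {0..<T})"
  proof (rule sobolev_time_deriv_pointwise[OF _ _ _ v(2) t])
    show "u t \<in> sobolev (s - 1) \<and> continuous_on UNIV (u t)" if "t \<in> {0..<T}" for t
      using C0 that sobolev_mono[of "s - 1" s] by (auto simp: sobolev_C0_def)
    show "v t \<in> sobolev (s - 1) \<and> continuous_on UNIV (v t)" if "t \<in> {0..<T}" for t
      using v(1) that by (auto simp: sobolev_C0_def)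
  qed (use s in simp)
  moreover have "v t x = - (u t x ^ n * deriv (u t) x) - deriv (inverse_helmholtz (nonlocal_density n (u t))) x"
    using eq[OF t, of x] by linarith
  ultimately show ?thesis by simp
qed

lemma solution_transport_equation:
  assumes s: "s > 3 / 2" and sol: "solution n T s u" and \<tau>: "\<tau> < T" and n: "n > 0"
  shows "\<exists>K C. transport_equation n \<tau> K C u (\<lambda>t. deriv (u t)) (\<lambda>t. deriv (inverse_helmholtz (nonlocal_density n (u t))))"
proof -
  have C0: "sobolev_C0 T s u" using sol by (simp add: solution_def)
  have u: "u t \<in> sobolev s" "continuous_on UNIV (u t)" if "t \<in> {0..\<tau>}" for t
    using C0 that \<tau> by (auto simp: sobolev_C0_def)
  obtain K where K: "K \<ge> 0" "\<And>t x. t \<in> {0..\<tau>} \<Longrightarrow> \<bar>u t x\<bar> \<le> K" "\<And>t x. t \<in> {0..\<tau>} \<Longrightarrow> \<bar>deriv (u t) x\<bar> \<le> K"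
    using solution_bounded[OF s C0 \<tau>] by blast
  have D0: "0 \<le> density_const n * K ^ n" using K by (simp add: density_const_def)
  have cont: "continuous_on UNIV (nonlocal_density n (u t))" if "t \<in> {0..\<tau>}" for t
    by (rule nonlocal_density_continuous[OF u(2)[OF that] sobolev_C1(2)[OF s u[OF that]]])
  \<comment> \<open>The factor 2 comes from the Lipschitz bound \<open>2 * M\<close> for
    \<open>deriv (inverse_helmholtz f)\<close>; the sup bound \<open>M\<close> fits below
    it.\<close>
  have "transport_equation n \<tau> K (2 * (density_const n * K ^ n)) u (\<lambda>t. deriv (u t)) (\<lambda>t. deriv (inverse_helmholtz (nonlocal_density n (u t))))"
  proof
    fix t x assume t: "t \<in> {0..\<tau>}"
    then have t': "t \<in> {0..<T}" using \<tau> by auto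
    show "(u t has_real_derivative deriv (u t) x) (at x)" by (rule sobolev_C1(1)[OF s u[OF t]])
    show "((\<lambda>t. u t x) has_real_derivative - (u t x ^ n * deriv (u t) x) - deriv (inverse_helmholtz (nonlocal_density n (u t))) x) (at t within {0..\<tau>})"
      by (rule DERIV_subset[OF solution_time_deriv[OF s sol t']]) (use \<tau> in auto)
  next
    fix t N x y assume t: "t \<in> {0..\<tau>}" and N: "N \<le> K" "\<And>x. \<bar>u t x\<bar> \<le> N \<and> \<bar>deriv (u t) x\<bar> \<le> N"
    have b: "\<bar>nonlocal_density n (u t) x\<bar> \<le> density_const n * K ^ n * N" for x
      using N by (intro nonlocal_density_bound n) auto
    have "0 \<le> N" using N(2)[of 0] by linarith
    then have D: "0 \<le> density_const n * K ^ n * N" using D0 by simp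
    show "\<bar>deriv (inverse_helmholtz (nonlocal_density n (u t))) x\<bar> \<le> 2 * (density_const n * K ^ n) * N"
      using inverse_helmholtz_deriv(3)[OF cont[OF t] b, of x] D by simp
    show "\<bar>deriv (inverse_helmholtz (nonlocal_density n (u t))) x - deriv (inverse_helmholtz (nonlocal_density n (u t))) y\<bar>
       \<le> 2 * (density_const n * K ^ n) * N * \<bar>x - y\<bar>"
      using inverse_helmholtz_deriv_lipschitz[OF cont[OF t] b, of x y] by (simp add: mult_ac)
  next
    \<comment> \<open>Half of \<open>e\<close> is spent on moving from \<open>t\<close> to
      \<open>a\<close>, uniformly in \<open>x\<close>, and half on the continuity of
      \<open>deriv (u a)\<close> at \<open>y\<close>.\<close>
    show "continuous_on ({0..\<tau>} \<times> UNIV) (\<lambda>(t, x). deriv (u t) x)"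
      unfolding continuous_on_iff
    proof (intro ballI allI impI)
      fix z :: "real \<times> real" and e :: real assume z: "z \<in> {0..\<tau>} \<times> UNIV" and e: "e > 0"
      obtain a y where zz: "z = (a, y)" by (cases z)
      have a: "a \<in> {0..\<tau>}" and a': "a \<in> {0..<T}" using z zz \<tau> by auto
      obtain d where d: "d > 0" "\<And>t x. t \<in> {0..<T} \<Longrightarrow> \<bar>t - a\<bar> < d \<Longrightarrow> \<bar>deriv (u t) x - deriv (u a) x\<bar> < e / 2"
        using sobolev_C0_uniform(2)[OF C0 a' half_gt_zero[OF e] s] by blast
      have "continuous_on UNIV (deriv (u a))" by (rule sobolev_C1(2)[OF s u[OF a]])
      then obtain d' where d': "d' > 0" "\<And>x. dist x y < d' \<Longrightarrow> dist (deriv (u a) x) (deriv (u a) y) < e / 2"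
        unfolding continuous_on_iff using half_gt_zero[OF e] by (metis UNIV_I)
      show "\<exists>d>0. \<forall>z'\<in>{0..\<tau>} \<times> UNIV. dist z' z < d \<longrightarrow> dist (case z' of (t, x) \<Rightarrow> deriv (u t) x) (case z of (t, x) \<Rightarrow> deriv (u t) x) < e"
      proof (intro exI[of _ "min d d'"] conjI ballI impI)
        fix z' :: "real \<times> real" assume z': "z' \<in> {0..\<tau>} \<times> UNIV" "dist z' z < min d d'"
        obtain t x where tx: "z' = (t, x)" by (cases z')
        have t: "t \<in> {0..<T}" using z' tx \<tau> by auto
        have "dist t a < d" "dist x y < d'"
          using z'(2) dist_fst_le[of z' z] dist_snd_le[of z' z] by (auto simp: tx zz)
        then show "dist (case z' of (t, x) \<Rightarrow> deriv (u t) x) (case z of (t, x) \<Rightarrow> deriv (u t) x) < e"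
          using d(2)[OF t, of x] d'(2)[of x] unfolding tx zz prod.case dist_real_def by linarith
      qed (use d d' in auto)
    qed
  qed (use K D0 in auto)
  then show ?thesis by blast
qed

section \<open>Vanishing on the whole line at one time, and at all times\<close>

lemma solution_vanishes_at:
  assumes n: "odd n" and s: "s > 3 / 2" and sol: "solution n T s u" and t: "t \<in> {0<..<T}" and ab: "a < b"
    and da: "((\<lambda>t. u t a) has_real_derivative 0) (at t)" and db: "((\<lambda>t. u t b) has_real_derivative 0) (at t)"
    and zero: "\<forall>x\<in>{a..b}. u t x = 0"
  shows "u t x = 0"
proof -
  have n0: "n > 0" using n odd_pos by blast
  have t': "t \<in> {0..<T}" using t by auto
  have C0: "sobolev_C0 T s u" using sol by (simp add: solution_def)
  have u: "u t \<in> sobolev s" "continuous_on UNIV (u t)" using C0 t' by (auto simp: sobolev_C0_def)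
  let ?f = "nonlocal_density n (u t)"
  let ?P = "inverse_helmholtz ?f"
  obtain K where K: "\<And>x. \<bar>u t x\<bar> \<le> K" "\<And>x. \<bar>deriv (u t) x\<bar> \<le> K"
  proof -
    obtain K where "\<forall>r\<in>{0..t}. \<forall>x. \<bar>u r x\<bar> \<le> K \<and> \<bar>deriv (u r) x\<bar> \<le> K"
      using solution_bounded[OF s C0, of t] t by auto
    then show ?thesis using t by (intro that[of K]) auto
  qed
  have cont: "continuous_on UNIV ?f"
    by (rule nonlocal_density_continuous[OF u(2) sobolev_C1(2)[OF s u]])
  have b: "\<bar>?f x\<bar> \<le> density_const n * K ^ n * K" for x
    by (rule nonlocal_density_bound[OF n0 order_refl K])
  have dP: "deriv ?P x = 0" if "x \<in> {a..b}" "((\<lambda>t. u t x) has_real_derivative 0) (at t)" for x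
  proof -
    \<comment> \<open>The open interval \<open>{0<..<T}\<close> makes the derivative from the
      equation two-sided, so that it can be compared with the assumed derivative 0.\<close>
    have "((\<lambda>t. u t x) has_real_derivative - (u t x ^ n * deriv (u t) x) - deriv ?P x) (at t within {0<..<T})"
      by (rule DERIV_subset[OF solution_time_deriv[OF s sol t']]) auto
    then have "((\<lambda>t. u t x) has_real_derivative - (u t x ^ n * deriv (u t) x) - deriv ?P x) (at t)"
      using t by (subst (asm) at_within_open) auto
    then have "- (u t x ^ n * deriv (u t) x) - deriv ?P x = 0"
      using that(2) by (rule DERIV_unique)
    then show ?thesis using zero that(1) n0 by (simp add: zero_power)
  qed
  have Pa: "deriv ?P a = 0" and Pb: "deriv ?P b = 0" using dP da db ab by auto
  \<comment> \<open>The mean value theorem for \<open>deriv ?P\<close>, whose derivative is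
    \<open>?P - ?f\<close>, needs no continuity beyond that of \<open>?f\<close> and places
    \<open>z\<close> strictly inside.\<close>
  have "\<exists>z. a < z \<and> z < b \<and> deriv ?P b - deriv ?P a = (b - a) * (?P z - ?f z)"
    by (rule MVT2[OF ab]) (rule inverse_helmholtz_deriv(2)[OF cont b])
  then obtain z where z: "a < z" "z < b" and mvt: "deriv ?P b - deriv ?P a = (b - a) * (?P z - ?f z)"
    by blast
  \<comment> \<open>For \<open>n = 1\<close> the factor \<open>u ^ (n - 1)\<close> equals 1 even
    where \<open>u\<close> vanishes, so the slope at \<open>z\<close> is needed too; it is 0 because
    \<open>u\<close> vanishes around the interior point \<open>z\<close>.\<close>
  have "deriv (u t) z = 0"
  proof (rule DERIV_imp_deriv, rule has_field_derivative_transform_within_open[where S = "{a<..<b}" and f = "\<lambda>_. 0"])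
    show "0 = u t x" if "x \<in> {a<..<b}" for x using zero that by simp
  qed (use z in auto)
  then have "?f z = 0" using zero z n0 by (simp add: nonlocal_density_def zero_power)
  then have "?P z = 0" using mvt Pa Pb ab by simp
  then have "?f x = 0"
    by (rule inverse_helmholtz_eq_0D[OF cont b nonlocal_density_nonneg(1)[OF n]])
  then show ?thesis by (rule nonlocal_density_nonneg(2)[OF n])
qed

theorem theorem2p6:
  fixes n :: nat and T s t_star a b :: real and u :: "real \<Rightarrow> real \<Rightarrow> real"
  assumes "odd n" and "T > 0" and "s > 3 / 2"
    and "solution n T s u"
    and "t_star \<in> {0<..<T}" and "a < b"
    and "((\<lambda>t. u t a) has_real_derivative 0) (at t_star)"
    and "((\<lambda>t. u t b) has_real_derivative 0) (at t_star)"
    and "\<forall>x\<in>{a..b}. u t_star x = 0"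
  shows "\<forall>t\<in>{0..<T}. \<forall>x. u t x = 0"
proof (intro ballI allI)
  fix t x assume t: "t \<in> {0..<T}"
  have n: "n > 0" using assms(1) odd_pos by blast
  have zero: "u t_star y = 0" for y
    by (rule solution_vanishes_at[OF assms(1,3,4,5,6,7,8,9)])
  show "u t x = 0"
  proof (cases "t_star \<le> t")
    case True
    \<comment> \<open>Constants are available on compact time intervals inside
      \<open>{0..<T}\<close>, so the horizon is the time to be reached.\<close>
    obtain K C where "transport_equation n t K C u (\<lambda>t. deriv (u t)) (\<lambda>t. deriv (inverse_helmholtz (nonlocal_density n (u t))))"
      using solution_transport_equation[OF assms(3,4) _ n, of t] t by auto
    from transport_equation.vanishes[OF transport_equation.shift[OF this], of t_star "t - t_star" x] show ?thesis
      using True assms(5) zero by simp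
  next
    case False
    \<comment> \<open>With horizon \<open>t_star\<close> the reversed solution has zero data at time
      0, and \<open>t\<close> turns into \<open>t_star - t\<close>.\<close>
    obtain K C where "transport_equation n t_star K C u (\<lambda>t. deriv (u t)) (\<lambda>t. deriv (inverse_helmholtz (nonlocal_density n (u t))))"
      using solution_transport_equation[OF assms(3,4) _ n, of t_star] assms(5) by auto
    from transport_equation.vanishes[OF transport_equation.time_reversal[OF this assms(1)], of "t_star - t" x] show ?thesis
      using False t zero by simp
  qed
qed

end
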